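(* Let $\mathbb K$ be a perfect field of cohomological dimension at most $1$ such that every homogeneous equation of degree $3$ in $8$ unknowns with coefficients in $\mathbb K$ admits non-trivial solutions in $\mathbb K^8$. Let $V$ be a vector space of dimension $n=9$ over $\mathbb K$. Then $R^\uparrow(H)\neq\emptyset$ for every hyperplane $H$ of $\mathcal G_3(V)$.
   Context: For $1\le k<n=\dim V$, $\mathcal G_k(V)$ is the point-line geometry whose points are the $k$-dimensional subspaces of $V$ and whose lines are the sets $\{X : Y\subset X\subset Z,\ \dim X=k\}$ with $Y\subset Z$ subspaces of $V$, $\dim Y=k-1$, $\dim Z=k+1$. A subspace of $\mathcal G_k(V)$ is a set $S$ of points containing every line that meets $S$ in at least two points; a hyperplane of $\mathcal G_k(V)$ is a proper subspace meeting every line non-trivially. It is known (Shult) that the hyperplanes of $\mathcal G_k(V)$ are exactly the sets of $k$-subspaces of $V$ on which a given non-trivial alternating $k$-linear form $\varphi$ on $V$ identically vanishes, $\varphi$ being unique up to a non-zero scalar. The upper radical $R^\uparrow(H)$ of a hyperplane $H$ of $\mathcal G_3(V)$ is the set of $2$-dimensional subspaces $A$ of $V$ such that every $3$-dimensional subspace of $V$ containing $A$ belongs to $H$. The cohomological dimension of a field $\mathbb K$ is the supremum over all primes $p$ of the $p$-cohomological dimension of the Galois group over $\mathbb K$ of the separable closure of $\mathbb K$. *)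

theory Defs
  imports
    "HOL-Analysis.Analysis"
    "HOL-Library.Poly_Mapping"
    "HOL-Library.Extended_Nat"
    "HOL-Algebra.Bij"
    "HOL-Algebra.Product_Groups"
    "HOL-Algebra.Algebraic_Closure_Type"
begin

section \<open>Grassmann geometries\<close>

text \<open>A vector space is given by its scalar multiplication \<open>scl\<close>, as in the library locale
  \<open>vector_space\<close>. Since \<open>vector_space.dim\<close> is 0 on infinite-dimensional
  spaces, the definitions below are meant for \<open>1 \<le> k\<close>.\<close>

definition grass_points ::
  "('k::field \<Rightarrow> 'v::ab_group_add \<Rightarrow> 'v) \<Rightarrow> nat \<Rightarrow> 'v set set" where
  "grass_points scl k = {U. module.subspace scl U \<and> vector_space.dim scl U = k}"

definition grass_lines ::
  "('k::field \<Rightarrow> 'v::ab_group_add \<Rightarrow> 'v) \<Rightarrow> nat \<Rightarrow> 'v set set set" where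
  "grass_lines scl k =
     {{U \<in> grass_points scl k. Y \<subset> U \<and> U \<subset> Z} | Y Z.
        module.subspace scl Y \<and> module.subspace scl Z \<and> Y \<subset> Z \<and>
        vector_space.dim scl Y = k - 1 \<and> vector_space.dim scl Z = k + 1}"

definition geom_subspace :: "'p set \<Rightarrow> 'p set set \<Rightarrow> 'p set \<Rightarrow> bool" where
  "geom_subspace P \<L> S \<longleftrightarrow>
     S \<subseteq> P \<and> (\<forall>L\<in>\<L>. (\<exists>x\<in>L \<inter> S. \<exists>y\<in>L \<inter> S. x \<noteq> y) \<longrightarrow> L \<subseteq> S)"

definition geom_hyperplane :: "'p set \<Rightarrow> 'p set set \<Rightarrow> 'p set \<Rightarrow> bool" where
  "geom_hyperplane P \<L> H \<longleftrightarrow>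
     geom_subspace P \<L> H \<and> H \<noteq> P \<and> (\<forall>L\<in>\<L>. L \<inter> H \<noteq> {})"

definition grass_hyperplane ::
  "('k::field \<Rightarrow> 'v::ab_group_add \<Rightarrow> 'v) \<Rightarrow> nat \<Rightarrow> 'v set set \<Rightarrow> bool" where
  "grass_hyperplane scl k H \<longleftrightarrow>
     geom_hyperplane (grass_points scl k) (grass_lines scl k) H"

definition upper_radical ::
  "('k::field \<Rightarrow> 'v::ab_group_add \<Rightarrow> 'v) \<Rightarrow> 'v set set \<Rightarrow> 'v set set" where
  "upper_radical scl H =
     {A \<in> grass_points scl 2. \<forall>U \<in> grass_points scl 3. A \<subseteq> U \<longrightarrow> U \<in> H}"


section \<open>Homogeneous polynomials in several unknowns\<close>

text \<open>A polynomial in unknowns indexed by \<open>'n\<close> is a finitely supported map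
  from exponent vectors to coefficients.\<close>

definition mpoly_eval ::
  "(('n::finite \<Rightarrow>\<^sub>0 nat) \<Rightarrow>\<^sub>0 'k::comm_semiring_1) \<Rightarrow> 'k ^ 'n \<Rightarrow> 'k" where
  "mpoly_eval f x =
     (\<Sum>m\<in>Poly_Mapping.keys f. Poly_Mapping.lookup f m * (\<Prod>i\<in>UNIV. x $ i ^ Poly_Mapping.lookup m i))"

definition mpoly_homogeneous ::
  "nat \<Rightarrow> (('n::finite \<Rightarrow>\<^sub>0 nat) \<Rightarrow>\<^sub>0 'k::comm_semiring_1) \<Rightarrow> bool" where
  "mpoly_homogeneous d f \<longleftrightarrow>
     (\<forall>m\<in>Poly_Mapping.keys f. (\<Sum>i\<in>UNIV. Poly_Mapping.lookup m i) = d)"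


section \<open>Perfect fields, separable closure and absolute Galois group\<close>

definition separable_poly :: "'k::field poly \<Rightarrow> bool" where
  "separable_poly f \<longleftrightarrow> rsquarefree (map_poly to_ac f)"

definition perfect_field :: "'k::field itself \<Rightarrow> bool" where
  "perfect_field _ \<longleftrightarrow>
     (\<forall>f :: 'k poly. Factorial_Ring.irreducible f \<longrightarrow> separable_poly f)"

text \<open>The separable closure is taken inside the algebraic closure of the library.\<close>

definition sep_closure :: "'k::field alg_closure set" where
  "sep_closure =
     {x. \<exists>f :: 'k poly. Factorial_Ring.irreducible f \<and> separable_poly f \<and> poly (map_poly to_ac f) x = 0}"

definition abs_galois_group :: "('k::field alg_closure \<Rightarrow> 'k alg_closure) monoid" where
  "abs_galois_group =
     (BijGroup sep_closure)
       \<lparr>carrier := {\<sigma> \<in> Bij sep_closure.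
          (\<forall>x\<in>sep_closure. \<forall>y\<in>sep_closure. \<sigma> (x + y) = \<sigma> x + \<sigma> y \<and> \<sigma> (x * y) = \<sigma> x * \<sigma> y) \<and>
          (\<forall>a :: 'k. \<sigma> (to_ac a) = to_ac a)}\<rparr>"

text \<open>The Krull topology is the topology of pointwise convergence on the discrete separable
  closure: the pointwise stabilisers of finite sets form a basis of neighbourhoods of 1.\<close>

definition krull_topology :: "('k::field alg_closure \<Rightarrow> 'k alg_closure) topology" where
  "krull_topology =
     subtopology (product_topology (\<lambda>_. discrete_topology sep_closure) sep_closure)
       (carrier abs_galois_group)"


section \<open>Cohomology of topological groups with discrete coefficients\<close>

text \<open>\<open>T\<close> is a topology on the carrier of the group \<open>G\<close>. Modules are abelian groups \<open>A\<close>,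
  written multiplicatively as usual in \<open>HOL-Algebra\<close>, with a left action \<open>act\<close> that is
  continuous for the discrete topology on \<open>A\<close>.\<close>

definition discrete_module ::
  "'g monoid \<Rightarrow> 'g topology \<Rightarrow> 'a monoid \<Rightarrow> ('g \<Rightarrow> 'a \<Rightarrow> 'a) \<Rightarrow> bool" where
  "discrete_module G T A act \<longleftrightarrow>
     comm_group A \<and>
     (\<forall>g\<in>carrier G. act g \<in> hom A A) \<and>
     (\<forall>a\<in>carrier A. act \<one>\<^bsub>G\<^esub> a = a) \<and>
     (\<forall>g\<in>carrier G. \<forall>h\<in>carrier G. \<forall>a\<in>carrier A. act (g \<otimes>\<^bsub>G\<^esub> h) a = act g (act h a)) \<and>
     continuous_map (prod_topology T (discrete_topology (carrier A)))
       (discrete_topology (carrier A)) (\<lambda>(g, a). act g a)"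

definition torsion_group :: "'a monoid \<Rightarrow> bool" where
  "torsion_group A \<longleftrightarrow> (\<forall>a\<in>carrier A. \<exists>m::nat. m > 0 \<and> a [^]\<^bsub>A\<^esub> m = \<one>\<^bsub>A\<^esub>)"

text \<open>Elements of \<open>G\<^sup>q\<close> are extensional functions on \<open>{..<q}\<close>.\<close>

definition group_tuples :: "'g monoid \<Rightarrow> nat \<Rightarrow> (nat \<Rightarrow> 'g) set" where
  "group_tuples G q = {..<q} \<rightarrow>\<^sub>E carrier G"

definition cochains ::
  "'g monoid \<Rightarrow> 'g topology \<Rightarrow> 'a monoid \<Rightarrow> nat \<Rightarrow> ((nat \<Rightarrow> 'g) \<Rightarrow> 'a) monoid" where
  "cochains G T A q =
     (product_group (group_tuples G q) (\<lambda>_. A))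
       \<lparr>carrier := {c \<in> group_tuples G q \<rightarrow>\<^sub>E carrier A.
          continuous_map (product_topology (\<lambda>_. T) {..<q}) (discrete_topology (carrier A)) c}\<rparr>"

text \<open>\<open>merge_at G q j (g\<^sub>0, \<dots>, g\<^sub>q) = (g\<^sub>0, \<dots>, g\<^sub>j g\<^sub>j\<^sub>+\<^sub>1, \<dots>, g\<^sub>q)\<close> for \<open>j < q\<close>\<close>

definition merge_at :: "'g monoid \<Rightarrow> nat \<Rightarrow> nat \<Rightarrow> (nat \<Rightarrow> 'g) \<Rightarrow> (nat \<Rightarrow> 'g)" where
  "merge_at G q j g =
     (\<lambda>i\<in>{..<q}. if i < j then g i else if i = j then g j \<otimes>\<^bsub>G\<^esub> g (Suc j) else g (Suc i))"

text \<open>The inhomogeneous differential; additively,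
  \<open>(dc)(g\<^sub>0, \<dots>, g\<^sub>q) = g\<^sub>0 c(g\<^sub>1, \<dots>, g\<^sub>q) + (\<Sum>j<q. (-1)\<^sup>j\<^sup>+\<^sup>1 c(g\<^sub>0, \<dots>, g\<^sub>j g\<^sub>j\<^sub>+\<^sub>1, \<dots>, g\<^sub>q))
     + (-1)\<^sup>q\<^sup>+\<^sup>1 c(g\<^sub>0, \<dots>, g\<^sub>q\<^sub>-\<^sub>1)\<close>.\<close>

definition coboundary ::
  "'g monoid \<Rightarrow> 'a monoid \<Rightarrow> ('g \<Rightarrow> 'a \<Rightarrow> 'a) \<Rightarrow> nat \<Rightarrow>
     ((nat \<Rightarrow> 'g) \<Rightarrow> 'a) \<Rightarrow> ((nat \<Rightarrow> 'g) \<Rightarrow> 'a)" where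
  "coboundary G A act q c =
     (\<lambda>g\<in>group_tuples G (Suc q).
        act (g 0) (c (\<lambda>i\<in>{..<q}. g (Suc i)))
        \<otimes>\<^bsub>A\<^esub> finprod A (\<lambda>j. c (merge_at G q j g) [^]\<^bsub>A\<^esub> ((-1) ^ Suc j :: int)) {..<q}
        \<otimes>\<^bsub>A\<^esub> c (\<lambda>i\<in>{..<q}. g i) [^]\<^bsub>A\<^esub> ((-1) ^ Suc q :: int))"

definition cocycles ::
  "'g monoid \<Rightarrow> 'g topology \<Rightarrow> 'a monoid \<Rightarrow> ('g \<Rightarrow> 'a \<Rightarrow> 'a) \<Rightarrow> nat \<Rightarrow>
     ((nat \<Rightarrow> 'g) \<Rightarrow> 'a) set" where
  "cocycles G T A act q =
     kernel (cochains G T A q) (cochains G T A (Suc q)) (coboundary G A act q)"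

definition coboundaries ::
  "'g monoid \<Rightarrow> 'g topology \<Rightarrow> 'a monoid \<Rightarrow> ('g \<Rightarrow> 'a \<Rightarrow> 'a) \<Rightarrow> nat \<Rightarrow>
     ((nat \<Rightarrow> 'g) \<Rightarrow> 'a) set" where
  "coboundaries G T A act q =
     (case q of
        0 \<Rightarrow> {\<one>\<^bsub>cochains G T A 0\<^esub>}
      | Suc r \<Rightarrow> coboundary G A act r ` carrier (cochains G T A r))"

definition cohomology_group ::
  "'g monoid \<Rightarrow> 'g topology \<Rightarrow> 'a monoid \<Rightarrow> ('g \<Rightarrow> 'a \<Rightarrow> 'a) \<Rightarrow> nat \<Rightarrow>
     ((nat \<Rightarrow> 'g) \<Rightarrow> 'a) set monoid" where
  "cohomology_group G T A act q =
     (cochains G T A q)\<lparr>carrier := cocycles G T A act q\<rparr> Mod coboundaries G T A act q"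

definition trivial_primary_component :: "nat \<Rightarrow> 'a monoid \<Rightarrow> bool" where
  "trivial_primary_component p M \<longleftrightarrow>
     (\<forall>x\<in>carrier M. (\<exists>m::nat. x [^]\<^bsub>M\<^esub> (p ^ m) = \<one>\<^bsub>M\<^esub>) \<longrightarrow> x = \<one>\<^bsub>M\<^esub>)"


section \<open>Cohomological dimension\<close>

text \<open>The \<open>p\<close>-cohomological dimension of a profinite group \<open>G\<close> is the infimum of the \<open>n\<close> such that
  for all discrete torsion \<open>G\<close>-modules \<open>A\<close> and all \<open>q > n\<close> the \<open>p\<close>-primary component of
  \<open>H\<^sup>q(G, A)\<close> is trivial. A formula of HOL cannot quantify over all types, so the
  underlying sets of the modules are subsets of the fixed type \<open>'g \<Rightarrow> nat\<close>. This does not change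
  the dimension: every discrete torsion module is the directed union of its finite submodules, and
  cohomology of profinite groups commutes with directed unions, so the modules with underlying set
  in any given infinite type suffice.\<close>

definition p_cohomological_dim :: "nat \<Rightarrow> 'g monoid \<Rightarrow> 'g topology \<Rightarrow> enat" where
  "p_cohomological_dim p G T =
     Inf {enat n | n. \<forall>(A :: ('g \<Rightarrow> nat) monoid) act q.
        discrete_module G T A act \<and> torsion_group A \<and> q > n \<longrightarrow>
        trivial_primary_component p (cohomology_group G T A act q)}"

definition field_cohomological_dim :: "'k::field itself \<Rightarrow> enat" where
  "field_cohomological_dim _ =
     (SUP p\<in>{p :: nat. Factorial_Ring.prime p}.
        p_cohomological_dim p (abs_galois_group :: ('k alg_closure \<Rightarrow> 'k alg_closure) monoid)
          krull_topology)"

end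

theory Submission
  imports Defs
begin

text \<open>A hyperplane \<open>H\<close> of the geometry of planes of \<open>V\<close> (subspaces of dimension 3) is the zero set of
  an alternating trilinear form \<open>\<phi>\<close>, by a theorem of Shult. The upper radical contains the span of any two
  independent vectors \<open>w\<close>, \<open>u\<close> with \<open>\<phi>(w, u, \<cdot>) = 0\<close>, so the point is to find such a
  singular pair.

  Split \<open>V = W \<oplus> \<langle>e\<rangle>\<close> with \<open>dim W = 8\<close>; let \<open>\<omega>\<close> be the restriction of \<open>\<phi>\<close> to \<open>W\<close> and
  \<open>M = \<phi>(e, \<cdot>, \<cdot>)\<close>, an alternating bilinear form on \<open>W\<close>. For \<open>w \<in> W\<close> write \<open>\<omega>\<^sub>w = \<omega>(w, \<cdot>, \<cdot>)\<close>. Its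
  radical contains \<open>w\<close>, so its Pfaffian vanishes and \<open>Pf(\<omega>\<^sub>w + t M)\<close> has no constant term. The
  coefficient \<open>q(w)\<close> of \<open>t\<close> is linear in \<open>M\<close> and of degree 3 in \<open>\<omega>\<^sub>w\<close>, hence a cubic form in the 8
  coordinates of \<open>w\<close>, and it has a zero \<open>w \<noteq> 0\<close> by hypothesis. Every such \<open>w\<close> is part of a singular
  pair. Indeed the rank of \<open>\<omega>\<^sub>w\<close> is even and less than 8. If it is at most 4, the radical of \<open>\<omega>\<^sub>w\<close> is so
  large that it contains some \<open>u\<close> outside \<open>\<langle>w\<rangle>\<close> with \<open>M(w, u) = 0\<close>. If it is 6, the radical is spanned
  by \<open>w\<close> and some \<open>u\<close>, and in a basis that begins with \<open>w\<close>, \<open>u\<close> and ends with three hyperbolic pairs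
  the coefficient of \<open>t\<close> is \<open>M(w, u)\<close>; it still vanishes, because a change of basis only multiplies it
  by a determinant, so again \<open>M(w, u) = 0\<close>. In both cases \<open>\<phi>(w, u, \<cdot>)\<close> vanishes on \<open>W\<close> and at \<open>e\<close>.
  The lemma \<open>singular_pair_from_form\<close> carries out this argument for any even dimension of \<open>W\<close>; the
  Pfaffian and the coefficient of \<open>t\<close> are alternating multilinear functions on lists of vectors
  (\<open>pfaffian\<close>, \<open>dpfaffian\<close>).

  For Shult's theorem the hyperplane is recorded as a relation \<open>h(x, y, z)\<close> that is symmetric,
  holds when two arguments coincide, and for fixed \<open>x\<close>, \<open>y\<close> is the kernel of a linear form in \<open>z\<close>.
  The form \<open>\<phi>\<close> is built one coordinate at a time. If it is known on a subspace \<open>U\<close>, and \<open>\<psi>\<close> is a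
  bilinear form for the relation \<open>h(e, \<cdot>, \<cdot>)\<close> on \<open>U\<close>, then on \<open>U \<oplus> \<langle>e\<rangle>\<close> it must be
  \<open>\<phi> + c (e\<^sup>* \<and> \<psi>)\<close> for some scalar \<open>c \<noteq> 0\<close>, where \<open>e\<^sup>*\<close> is the coordinate along \<open>e\<close>. For a
  single pair \<open>(y, z)\<close> of vectors of \<open>U\<close> some \<open>c\<close> is suitable, and the core of the proof (\<open>null_rel2_extend\<close>,
  \<open>null_rel3_extend\<close>) is that one \<open>c\<close> suits all pairs: two pairs with a common vector that
  determine \<open>c\<close> prescribe the same value, and any two pairs that determine \<open>c\<close> are joined by a path
  of such pairs.\<close>

section \<open>Linear and alternating forms\<close>

abbreviation linear_form :: "('k::field \<Rightarrow> 'v::ab_group_add \<Rightarrow> 'v) \<Rightarrow> ('v \<Rightarrow> 'k) \<Rightarrow> bool"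
  where "linear_form scl f \<equiv> Vector_Spaces.linear scl (*) f"

definition alternating2 ::
  "('k::field \<Rightarrow> 'v::ab_group_add \<Rightarrow> 'v) \<Rightarrow> ('v \<Rightarrow> 'v \<Rightarrow> 'k) \<Rightarrow> bool" where
  "alternating2 scl \<beta> \<longleftrightarrow>
     (\<forall>x. linear_form scl (\<beta> x)) \<and> (\<forall>y. linear_form scl (\<lambda>x. \<beta> x y)) \<and> (\<forall>x. \<beta> x x = 0)"

text \<open>Alternation in the two pairs of adjacent arguments implies alternation in the first and the third.\<close>

definition alternating3 ::
  "('k::field \<Rightarrow> 'v::ab_group_add \<Rightarrow> 'v) \<Rightarrow> ('v \<Rightarrow> 'v \<Rightarrow> 'v \<Rightarrow> 'k) \<Rightarrow> bool" where
  "alternating3 scl \<tau> \<longleftrightarrow>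
     (\<forall>x. alternating2 scl (\<tau> x)) \<and> (\<forall>z. alternating2 scl (\<lambda>x y. \<tau> x y z))"

context vector_space
begin

lemma linear_form_iff:
  "linear_form scale f \<longleftrightarrow> (\<forall>x y. f (x + y) = f x + f y) \<and> (\<forall>c x. f (scale c x) = c * f x)"
proof -
  have "vector_space ((*) :: 'a \<Rightarrow> 'a \<Rightarrow> 'a)" by unfold_locales (auto simp: algebra_simps)
  then show ?thesis unfolding Vector_Spaces.linear_iff using vector_space_axioms by auto
qed

lemma
  assumes "linear_form scale f"
  shows linear_form_add: "f (x + y) = f x + f y"
    and linear_form_scale: "f (scale c x) = c * f x"
    and linear_form_zero: "f 0 = 0"
    and linear_form_minus: "f (- x) = - f x"
    and linear_form_diff: "f (x - y) = f x - f y"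
proof -
  show a: "f (x + y) = f x + f y" for x y using assms by (simp add: linear_form_iff)
  show s: "f (scale c x) = c * f x" for c x using assms by (simp add: linear_form_iff)
  show z: "f 0 = 0" using s[of 0 0] by simp
  show m: "f (- x) = - f x" for x using a[of x "- x"] z by (simp add: eq_neg_iff_add_eq_0 add.commute)
  show "f (x - y) = f x - f y" using a[of x "- y"] m[of y] by simp
qed

lemmas linear_form_simps = linear_form_add linear_form_scale linear_form_zero linear_form_minus linear_form_diff

lemma linear_form_sum: "linear_form scale f \<Longrightarrow> f (sum g S) = (\<Sum>i\<in>S. f (g i))"
  by (induction S rule: infinite_finite_induct) (simp_all add: linear_form_simps)

lemma linear_form_const_zero: "linear_form scale (\<lambda>x. 0)"
  and linear_form_plus: "linear_form scale f \<Longrightarrow> linear_form scale g \<Longrightarrow> linear_form scale (\<lambda>x. f x + g x)"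
  by (auto simp: linear_form_iff algebra_simps)

lemma linear_form_comp:
  "linear_form scale f \<Longrightarrow> Vector_Spaces.linear scale scale P \<Longrightarrow> linear_form scale (\<lambda>x. f (P x))"
  unfolding linear_form_iff by (auto simp: Vector_Spaces.linear_iff)

text \<open>Evaluation at a vector outside the common kernel gives the factor of proportionality.\<close>

lemma same_kernel_proportional:
  assumes "linear_form scale f" "linear_form scale g" "\<And>x. f x = 0 \<longleftrightarrow> g x = 0"
  obtains m where "m \<noteq> 0" "\<And>x. f x = m * g x"
proof (cases "\<exists>u. g u \<noteq> 0")
  case True
  then obtain u where u: "g u \<noteq> 0" by blast
  have "f x = (f u / g u) * g x" for x
  proof -
    have "g (x - scale (g x / g u) u) = 0"
      using u by (simp add: linear_form_simps[OF assms(2)])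
    then have "f (x - scale (g x / g u) u) = 0" using assms(3) by blast
    then show ?thesis by (simp add: linear_form_simps[OF assms(1)])
  qed
  moreover have "f u / g u \<noteq> 0" using u assms(3) by simp
  ultimately show ?thesis using that by blast
next
  case False
  then show ?thesis using that[of 1] assms(3) by auto
qed

lemma two_forms_nonzero:
  assumes "linear_form scale f" "linear_form scale g" "\<exists>x. f x \<noteq> 0" "\<exists>x. g x \<noteq> 0"
  shows "\<exists>x. f x \<noteq> 0 \<and> g x \<noteq> 0"
proof -
  obtain a b where ab: "f a \<noteq> 0" "g b \<noteq> 0" using assms by blast
  show ?thesis
  proof (cases "g a = 0 \<and> f b = 0")
    case True
    then have "f (a + b) \<noteq> 0 \<and> g (a + b) \<noteq> 0"
      using ab by (simp add: linear_form_simps[OF assms(1)] linear_form_simps[OF assms(2)])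
    then show ?thesis by blast
  qed (use ab in blast)
qed

text \<open>Over the field with two elements this fails for independent \<open>f\<close>, \<open>g\<close> and \<open>f + g\<close>, which is why a scalar other
  than 0 and 1 is required. Start from \<open>a\<close> outside two of the kernels and \<open>b\<close> outside the third: one of
  \<open>a\<close>, \<open>b\<close>, \<open>a + b\<close>, \<open>a + s b\<close> works.\<close>

lemma three_forms_nonzero:
  assumes lin: "linear_form scale f" "linear_form scale g" "linear_form scale k"
    and ne: "\<exists>x. f x \<noteq> 0" "\<exists>x. g x \<noteq> 0" "\<exists>x. k x \<noteq> 0"
    and s: "(s :: 'a) \<noteq> 0" "s \<noteq> 1"
  shows "\<exists>x. f x \<noteq> 0 \<and> g x \<noteq> 0 \<and> k x \<noteq> 0"
proof -
  have key: "\<exists>x. f x \<noteq> 0 \<and> g x \<noteq> 0 \<and> k x \<noteq> 0"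
    if lin': "linear_form scale f" "linear_form scale g"
      and a: "f a \<noteq> 0" "g a \<noteq> 0" "k a = 0" and b: "k b \<noteq> 0" "f b = 0"
    for a b f g
  proof (cases "g (a + b) = 0")
    case False
    then have "f (a + b) \<noteq> 0 \<and> g (a + b) \<noteq> 0 \<and> k (a + b) \<noteq> 0"
      using a b by (simp add: linear_form_simps[OF lin'(1)] linear_form_simps[OF lin(3)])
    then show ?thesis by blast
  next
    case True
    then have "g b = - g a" by (simp add: linear_form_simps[OF lin'(2)] add_eq_0_iff)
    then have "g (a + scale s b) = (1 - s) * g a"
      by (simp add: linear_form_simps[OF lin'(2)] algebra_simps)
    then have "f (a + scale s b) \<noteq> 0 \<and> g (a + scale s b) \<noteq> 0 \<and> k (a + scale s b) \<noteq> 0"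
      using a b s by (simp add: linear_form_simps[OF lin'(1)] linear_form_simps[OF lin(3)])
    then show ?thesis by blast
  qed
  obtain a where a: "f a \<noteq> 0" "g a \<noteq> 0" using two_forms_nonzero[OF lin(1,2) ne(1,2)] by blast
  obtain b where b: "k b \<noteq> 0" using ne(3) by blast
  consider "k a \<noteq> 0" | "f b \<noteq> 0" "g b \<noteq> 0" | "k a = 0" "f b = 0" | "k a = 0" "g b = 0" by blast
  then show ?thesis
  proof cases
    case 3 then show ?thesis using key[OF lin(1,2)] a b by blast
  next
    case 4 then show ?thesis using key[OF lin(2,1)] a b by blast
  qed (use a b in blast)+
qed

lemma
  assumes "alternating2 scale \<beta>"
  shows alternating2_right: "linear_form scale (\<beta> x)"
    and alternating2_left: "linear_form scale (\<lambda>x. \<beta> x y)"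
    and alternating2_self: "\<beta> x x = 0"
    and alternating2_swap: "\<beta> x y = - \<beta> y x"
proof -
  show r: "linear_form scale (\<beta> x)" and l: "linear_form scale (\<lambda>x. \<beta> x y)" and s: "\<beta> x x = 0" for x y
    using assms by (auto simp: alternating2_def)
  show "\<beta> x y = - \<beta> y x"
  proof -
    have "\<beta> x y + \<beta> y x = (\<beta> x x + \<beta> x y) + (\<beta> y x + \<beta> y y)" by (simp add: s)
    also have "\<dots> = \<beta> x (x + y) + \<beta> y (x + y)" by (simp only: linear_form_add[OF r])
    also have "\<dots> = \<beta> (x + y) (x + y)" by (simp only: linear_form_add[OF l])
    finally show ?thesis by (simp add: s eq_neg_iff_add_eq_0)
  qed
qed

lemma
  assumes "alternating3 scale \<tau>"
  shows alternating3_fst: "alternating2 scale (\<tau> x)"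
    and alternating3_snd: "alternating2 scale (\<lambda>x z. \<tau> x y z)"
    and alternating3_thd: "alternating2 scale (\<lambda>x y. \<tau> x y z)"
    and alternating3_swap12: "\<tau> x y z = - \<tau> y x z"
    and alternating3_swap23: "\<tau> x y z = - \<tau> x z y"
proof -
  show f: "alternating2 scale (\<tau> x)" and t: "alternating2 scale (\<lambda>x y. \<tau> x y z)" for x z
    using assms by (auto simp: alternating3_def)
  show a: "\<tau> x y z = - \<tau> y x z" for x y z using alternating2_swap[OF t] .
  show "\<tau> x y z = - \<tau> x z y" for x y z using alternating2_swap[OF f] .
  show "alternating2 scale (\<lambda>x z. \<tau> x y z)"
    unfolding alternating2_def
  proof (intro conjI allI)
    fix x z
    show "linear_form scale (\<tau> x y)" by (rule alternating2_right[OF f])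
    show "linear_form scale (\<lambda>x. \<tau> x y z)" by (rule alternating2_left[OF t])
    show "\<tau> x y x = 0" using a[of x y x] alternating2_self[OF f] by simp
  qed
qed

end

section \<open>Null relations\<close>

text \<open>The relation of conjugacy with respect to a possibly degenerate null polarity, without reference to
  a form. The perpendicular of \<open>x\<close> is required to be the kernel of a linear form, which may be zero; this
  says that it is a hyperplane or the whole space.\<close>

definition null_rel2 ::
  "('k::field \<Rightarrow> 'v::ab_group_add \<Rightarrow> 'v) \<Rightarrow> ('v \<Rightarrow> 'v \<Rightarrow> bool) \<Rightarrow> bool" where
  "null_rel2 scl h \<longleftrightarrow>
     (\<forall>x. \<exists>f. linear_form scl f \<and> (\<forall>y. h x y \<longleftrightarrow> f y = 0)) \<and>
     (\<forall>x y. h x y \<longrightarrow> h y x) \<and> (\<forall>x. h x x)"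

definition null_rel3 ::
  "('k::field \<Rightarrow> 'v::ab_group_add \<Rightarrow> 'v) \<Rightarrow> ('v \<Rightarrow> 'v \<Rightarrow> 'v \<Rightarrow> bool) \<Rightarrow> bool" where
  "null_rel3 scl h \<longleftrightarrow>
     (\<forall>x. null_rel2 scl (h x)) \<and> (\<forall>z. null_rel2 scl (\<lambda>x y. h x y z))"

context vector_space
begin

lemma
  assumes "null_rel2 scale h"
  shows null_rel2_form: "\<exists>f. linear_form scale f \<and> (\<forall>y. h x y \<longleftrightarrow> f y = 0)"
    and null_rel2_swap: "h x y \<longleftrightarrow> h y x"
    and null_rel2_self: "h x x"
  using assms unfolding null_rel2_def by blast+

lemma null_rel2_combination:
  assumes "null_rel2 scale h" "h x y" "h x z"
  shows "h x (scale s y + scale t z)"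
proof -
  obtain f where f: "linear_form scale f" "\<And>y. h x y \<longleftrightarrow> f y = 0"
    using null_rel2_form[OF assms(1)] by blast
  then show ?thesis using assms(2,3) by (simp add: linear_form_simps[OF f(1)])
qed

lemma null_rel2_shift:
  assumes "null_rel2 scale h"
  shows "h x (y + scale s x) \<longleftrightarrow> h x y"
proof -
  obtain f where f: "linear_form scale f" "\<And>y. h x y \<longleftrightarrow> f y = 0"
    using null_rel2_form[OF assms(1)] by blast
  then show ?thesis using null_rel2_self[OF assms(1), of x] by (simp add: linear_form_simps[OF f(1)])
qed

lemma null_rel2_scale:
  assumes "null_rel2 scale h" "s \<noteq> 0"
  shows "h (scale s x) y \<longleftrightarrow> h x y"
proof -
  obtain f where f: "linear_form scale f" "\<And>x. h y x \<longleftrightarrow> f x = 0"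
    using null_rel2_form[OF assms(1)] by blast
  then have "h y (scale s x) \<longleftrightarrow> h y x" using assms(2) by (simp add: linear_form_simps[OF f(1)])
  then show ?thesis using null_rel2_swap[OF assms(1)] by blast
qed

lemma
  assumes "null_rel3 scale h"
  shows null_rel3_fst: "null_rel2 scale (h x)"
    and null_rel3_thd: "null_rel2 scale (\<lambda>x y. h x y z)"
    and null_rel3_swap12: "h x y z \<longleftrightarrow> h y x z"
    and null_rel3_swap23: "h x y z \<longleftrightarrow> h x z y"
proof -
  show f: "null_rel2 scale (h x)" and t: "null_rel2 scale (\<lambda>x y. h x y z)" for x z
    using assms by (auto simp: null_rel3_def)
  show "h x y z \<longleftrightarrow> h y x z" for x y z using null_rel2_swap[OF t] .
  show "h x y z \<longleftrightarrow> h x z y" for x y z using null_rel2_swap[OF f] .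
qed

lemma null_rel2_comp:
  assumes "null_rel2 scale h" "Vector_Spaces.linear scale scale P"
  shows "null_rel2 scale (\<lambda>x y. h (P x) (P y))"
  unfolding null_rel2_def
proof (intro conjI allI impI)
  fix x
  obtain f where f: "linear_form scale f" "\<And>y. h (P x) y \<longleftrightarrow> f y = 0"
    using null_rel2_form[OF assms(1)] by blast
  show "\<exists>g. linear_form scale g \<and> (\<forall>y. h (P x) (P y) \<longleftrightarrow> g y = 0)"
    by (rule exI[of _ "\<lambda>y. f (P y)"]) (use f linear_form_comp[OF f(1) assms(2)] in blast)
qed (use null_rel2_swap[OF assms(1)] null_rel2_self[OF assms(1)] in blast)+

lemma null_rel3_comp:
  assumes "null_rel3 scale h" "Vector_Spaces.linear scale scale P"
  shows "null_rel3 scale (\<lambda>x y z. h (P x) (P y) (P z))"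
  unfolding null_rel3_def
  using null_rel2_comp[OF null_rel3_fst[OF assms(1)] assms(2)] null_rel2_comp[OF null_rel3_thd[OF assms(1)] assms(2)]
  by blast

text \<open>Both sides are unchanged when a multiple of one argument is added to the other, and when an argument
  is rescaled. If \<open>l x \<noteq> 0\<close>, this allows \<open>x\<close> to be normalised to \<open>l x = 1\<close> and \<open>y\<close> to be moved into the
  kernel of \<open>l\<close>, so only the normalised cases need to be compared.\<close>

lemma null_rel2_eqI:
  assumes h: "null_rel2 scale h" and \<beta>: "alternating2 scale \<beta>" and l: "linear_form scale l"
    and zero: "\<And>x y. l x = 0 \<Longrightarrow> l y = 0 \<Longrightarrow> h x y \<longleftrightarrow> \<beta> x y = 0"
    and one: "\<And>x y. l x = 1 \<Longrightarrow> l y = 0 \<Longrightarrow> h x y \<longleftrightarrow> \<beta> x y = 0"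
  shows "h x y \<longleftrightarrow> \<beta> x y = 0"
proof -
  note bl = linear_form_simps[OF alternating2_right[OF \<beta>]] linear_form_simps[OF alternating2_left[OF \<beta>]]
  have red: "h x y \<longleftrightarrow> \<beta> x y = 0" if nz: "l x \<noteq> 0" for x y
  proof -
    define x' where "x' = scale (1 / l x) x"
    define y' where "y' = y + scale (- (l y / l x)) x"
    have "l x' = 1" "l y' = 0" using nz by (simp_all add: x'_def y'_def linear_form_simps[OF l])
    then have *: "h x' y' \<longleftrightarrow> \<beta> x' y' = 0" by (rule one)
    have "h x' y' \<longleftrightarrow> h x y'" unfolding x'_def by (rule null_rel2_scale[OF h]) (use nz in simp)
    also have "\<dots> \<longleftrightarrow> h x y" unfolding y'_def by (rule null_rel2_shift[OF h])
    finally have 1: "h x' y' \<longleftrightarrow> h x y" .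
    have "\<beta> x' y' = (1 / l x) * \<beta> x y"
      unfolding x'_def y'_def by (simp add: bl alternating2_self[OF \<beta>])
    then show ?thesis using * 1 nz by simp
  qed
  show ?thesis
  proof (cases "l x = 0 \<and> l y = 0")
    case True then show ?thesis using zero by blast
  next
    case False
    moreover have "\<beta> x y = 0 \<longleftrightarrow> \<beta> y x = 0"
      by (subst alternating2_swap[OF \<beta>]) simp
    ultimately show ?thesis using red[of x y] red[of y x] null_rel2_swap[OF h, of x y] by blast
  qed
qed

text \<open>Normalise the first two arguments while the third lies in the kernel of \<open>l\<close>, then the last two.\<close>

lemma null_rel3_eqI:
  assumes h: "null_rel3 scale h" and \<tau>: "alternating3 scale \<tau>" and l: "linear_form scale l"
    and zero: "\<And>x y z. l x = 0 \<Longrightarrow> l y = 0 \<Longrightarrow> l z = 0 \<Longrightarrow> h x y z \<longleftrightarrow> \<tau> x y z = 0"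
    and one: "\<And>x y z. l x = 1 \<Longrightarrow> l y = 0 \<Longrightarrow> l z = 0 \<Longrightarrow> h x y z \<longleftrightarrow> \<tau> x y z = 0"
  shows "h x y z \<longleftrightarrow> \<tau> x y z = 0"
proof -
  have z0: "h x y z \<longleftrightarrow> \<tau> x y z = 0" if "l z = 0" for x y z
    using null_rel2_eqI[OF null_rel3_thd[OF h] alternating3_thd[OF \<tau>] l] zero one that by blast
  have z1: "h x y z \<longleftrightarrow> \<tau> x y z = 0" if "l y = 0" for x y z
  proof -
    have "\<tau> x y z = 0 \<longleftrightarrow> \<tau> x z y = 0"
      by (subst alternating3_swap23[OF \<tau>]) simp
    then show ?thesis using z0[OF that, of x z] null_rel3_swap23[OF h, of x y z] by blast
  qed
  show ?thesis
    using null_rel2_eqI[OF null_rel3_fst[OF h] alternating3_fst[OF \<tau>] l] z0 z1 by blast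
qed

end

section \<open>Null relations are the zero sets of alternating forms\<close>

context vector_space
begin

text \<open>The relation \<open>h\<close> is given by \<open>\<phi>\<close> on the image of \<open>P\<close> and by \<open>\<psi>\<close> between \<open>e\<close> and this image; the scalar
  \<open>c\<close> glues the two. For a fixed \<open>y\<close> such a \<open>c\<close> exists because two forms with the same kernel are
  proportional, and it is determined by \<open>y\<close> unless \<open>\<psi> y = 0\<close> or \<open>\<phi> \<cdot> y = 0\<close>. If \<open>y\<close> and
  \<open>z\<close> both determine their scalars and \<open>\<phi> y z \<noteq> 0\<close>, the scalars agree; for any two such \<open>y\<close>, \<open>y'\<close> there
  is a \<open>z\<close> for which this applies to \<open>(z, y)\<close> and \<open>(z, y')\<close>. Over the field with two elements there is nothing to prove, since \<open>c = 1\<close>.\<close>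

lemma null_rel2_extend:
  assumes h: "null_rel2 scale h" and P: "Vector_Spaces.linear scale scale P"
    and \<phi>: "alternating2 scale \<phi>" "\<And>x y. h (P x) (P y) \<longleftrightarrow> \<phi> x y = 0"
    and \<psi>: "linear_form scale \<psi>" "\<And>y. h e (P y) \<longleftrightarrow> \<psi> y = 0"
  shows "\<exists>c. c \<noteq> 0 \<and> (\<forall>x y. h (e + P x) (P y) \<longleftrightarrow> \<phi> x y + c * \<psi> y = 0)"
proof -
  note hswap = null_rel2_swap[OF h]
  note \<phi>l = linear_form_simps[OF alternating2_left[OF \<phi>(1)]]
  define C where "C y c \<longleftrightarrow> c \<noteq> 0 \<and> (\<forall>x. h (e + P x) (P y) \<longleftrightarrow> \<phi> x y + c * \<psi> y = 0)" for y c
  have ex: "\<exists>c. C y c" for y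
  proof -
    obtain f where f: "linear_form scale f" "\<And>v. h (P y) v \<longleftrightarrow> f v = 0"
      using null_rel2_form[OF h] by blast
    have "f (P x) = 0 \<longleftrightarrow> \<phi> x y = 0" for x
      using f(2) \<phi>(2) hswap by blast
    then obtain m where m: "m \<noteq> 0" "\<And>x. f (P x) = m * \<phi> x y"
      using same_kernel_proportional[OF linear_form_comp[OF f(1) P] alternating2_left[OF \<phi>(1)]] by blast
    have fe: "f e = 0 \<longleftrightarrow> \<psi> y = 0" using f(2) \<psi>(2) hswap by blast
    define c where "c = (if \<psi> y = 0 then 1 else f e / (m * \<psi> y))"
    have c0: "c \<noteq> 0" using fe m(1) by (simp add: c_def)
    have "f (e + P x) = m * (\<phi> x y + c * \<psi> y)" for x
      using fe m(1) by (simp add: c_def linear_form_simps[OF f(1)] m(2) field_simps)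
    then have "h (e + P x) (P y) \<longleftrightarrow> \<phi> x y + c * \<psi> y = 0" for x
      using f(2)[of "e + P x"] hswap m(1) by (metis mult_eq_0_iff)
    then show ?thesis using c0 unfolding C_def by blast
  qed
  have eq: "c = d" if yz: "\<phi> y z \<noteq> 0" "\<psi> y \<noteq> 0" "\<psi> z \<noteq> 0" and c: "C y c" and d: "C z d" for y z c d
  proof -
    \<comment> \<open>The vector \<open>e + P x\<close> is perpendicular to \<open>P y\<close> and \<open>P z\<close>, hence to \<open>P x\<close>, hence to \<open>e\<close>. So
      \<open>\<psi> x = 0\<close>, and this is the equation \<open>c = d\<close>.\<close>
    define s where "s = - (d * \<psi> z / \<phi> y z)"
    define t where "t = c * \<psi> y / \<phi> y z"
    define x where "x = scale s y + scale t z"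
    have zy: "\<phi> z y = - \<phi> y z" by (rule alternating2_swap[OF \<phi>(1)])
    have "\<phi> x y + c * \<psi> y = 0" "\<phi> x z + d * \<psi> z = 0"
      using yz(1) by (simp_all add: x_def s_def t_def \<phi>l alternating2_self[OF \<phi>(1)] zy)
    then have "h (e + P x) (P y)" "h (e + P x) (P z)" using c d by (auto simp: C_def)
    then have "h (e + P x) (scale s (P y) + scale t (P z))" by (rule null_rel2_combination[OF h])
    then have "h (e + P x) (P x)" using P by (simp add: x_def Vector_Spaces.linear_iff)
    then have "h (e + P x) (scale 1 (e + P x) + scale (- 1) (P x))"
      by (intro null_rel2_combination[OF h] null_rel2_self[OF h])
    then have "h e (e + P x)" using hswap by simp
    then have "h e (scale 1 (e + P x) + scale (- 1) e)"
      by (intro null_rel2_combination[OF h] null_rel2_self[OF h])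
    then have "\<psi> x = 0" using \<psi>(2) by simp
    then have "(c - d) * (\<psi> y * \<psi> z) = 0"
      using yz(1) by (simp add: x_def s_def t_def linear_form_simps[OF \<psi>(1)] field_simps)
    then show ?thesis using yz by simp
  qed
  have irr: "C y c" if d: "C y d" and c: "c \<noteq> 0" and y: "\<psi> y = 0 \<or> (\<forall>x. \<phi> x y = 0)" for y c d
  proof -
    have "\<phi> x y + d * \<psi> y = 0 \<longleftrightarrow> \<phi> x y + c * \<psi> y = 0" for x
      using d c y unfolding C_def by (elim disjE) simp_all
    then show ?thesis using d c unfolding C_def by blast
  qed
  have "\<exists>c. \<forall>y. C y c"
  proof (cases "\<exists>y x. \<psi> y \<noteq> 0 \<and> \<phi> x y \<noteq> 0")
    case False
    then have "C y 1" for y using ex[of y] irr[of y _ 1] by (metis one_neq_zero)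
    then show ?thesis by blast
  next
    case True
    then obtain y0 x0 where y0: "\<psi> y0 \<noteq> 0" "\<phi> x0 y0 \<noteq> 0" by blast
    obtain c where c: "C y0 c" using ex by blast
    have "C y c" for y
    proof (cases "\<psi> y \<noteq> 0 \<and> (\<exists>x. \<phi> x y \<noteq> 0)")
      case False
      then show ?thesis using ex[of y] irr[of y _ c] c unfolding C_def by blast
    next
      case live: True
      obtain d where d: "C y d" using ex by blast
      have "d = c"
      proof (cases "\<exists>s :: 'a. s \<noteq> 0 \<and> s \<noteq> 1")
        case True
        then obtain z where z: "\<phi> z y0 \<noteq> 0" "\<phi> z y \<noteq> 0" "\<psi> z \<noteq> 0"
          using three_forms_nonzero[OF alternating2_left[OF \<phi>(1)] alternating2_left[OF \<phi>(1)] \<psi>(1)] y0 live by metis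
        obtain b where b: "C z b" using ex by blast
        show ?thesis using eq[OF z(1,3) y0(1) b c] eq[OF z(2,3) _ b d] live by simp
      next
        case False
        then show ?thesis using c d unfolding C_def by metis
      qed
      then show ?thesis using d by simp
    qed
    then show ?thesis by blast
  qed
  then show ?thesis unfolding C_def by blast
qed

text \<open>The conditions say that \<open>z\<close> avoids the kernels of \<open>\<alpha>\<close>, \<open>\<alpha>'\<close> and the radicals of \<open>\<beta>\<close>, \<open>\<beta>'\<close>. Over the field
  with three elements four hyperplanes can cover the space, so it matters that the radical of a
  non-zero alternating form has codimension at least 2. Take \<open>u\<close> outside both kernels and let \<open>K\<close> be the
  intersection of the kernels. All of \<open>u + K\<close> avoids the kernels, so it suffices to find an
  element of \<open>u + K\<close> outside both radicals. A radical that contains \<open>K\<close> misses \<open>u + K\<close> altogether, and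
  otherwise it contains at most one of \<open>u\<close>, \<open>u + k\<close>, \<open>u + s k\<close> for suitable \<open>k \<in> K\<close>.\<close>

lemma pair_nonzero_avoiding:
  assumes a: "linear_form scale \<alpha>" "linear_form scale \<alpha>'" "\<exists>x. \<alpha> x \<noteq> 0" "\<exists>x. \<alpha>' x \<noteq> 0"
    and b: "alternating2 scale \<beta>" "alternating2 scale \<beta>'" "\<exists>x y. \<beta> x y \<noteq> 0" "\<exists>x y. \<beta>' x y \<noteq> 0"
    and s: "(s :: 'a) \<noteq> 0" "s \<noteq> 1"
  shows "\<exists>z. \<alpha> z \<noteq> 0 \<and> \<alpha>' z \<noteq> 0 \<and> (\<exists>x. \<beta> x z \<noteq> 0) \<and> (\<exists>x. \<beta>' x z \<noteq> 0)"
proof -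
  obtain u where u: "\<alpha> u \<noteq> 0" "\<alpha>' u \<noteq> 0" using two_forms_nonzero[OF a] by blast
  define K where "K = {k. \<alpha> k = 0 \<and> \<alpha>' k = 0}"
  have K0: "0 \<in> K" and Ks: "k \<in> K \<Longrightarrow> scale c k \<in> K" for k c
    by (auto simp: K_def linear_form_simps[OF a(1)] linear_form_simps[OF a(2)])
  have Ku: "\<alpha> (u + k) \<noteq> 0 \<and> \<alpha>' (u + k) \<noteq> 0" if "k \<in> K" for k
    using that u by (simp add: K_def linear_form_simps[OF a(1)] linear_form_simps[OF a(2)])
  define R where "R \<beta> = {z. \<forall>x. \<beta> x z = 0}" for \<beta> :: "'b \<Rightarrow> 'b \<Rightarrow> 'a"
  \<comment> \<open>A radical containing \<open>K\<close> and \<open>u\<close> would have codimension at most 1: modulo \<open>u\<close> every vector lies in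
    the kernel of \<open>\<alpha>\<close>, and there the form factors through \<open>\<alpha>'\<close>, a space of dimension 1.\<close>
  have big: False if alt: "alternating2 scale \<beta>" and ne: "\<exists>x y. \<beta> x y \<noteq> 0"
    and KR: "K \<subseteq> R \<beta>" and uR: "u \<in> R \<beta>" for \<beta>
  proof -
    note l = linear_form_simps[OF alternating2_left[OF alt]] linear_form_simps[OF alternating2_right[OF alt]]
    have R0: "\<beta> x k = 0" "\<beta> k x = 0" if "k \<in> R \<beta>" for x k
      using that alternating2_swap[OF alt, of k x] by (auto simp: R_def)
    define red where "red z = z - scale (\<alpha> z / \<alpha> u) u" for z
    have red0: "\<alpha> (red z) = 0" for z using u by (simp add: red_def linear_form_simps[OF a(1)])
    have redb: "\<beta> (red y) (red z) = \<beta> y z" for y z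
      by (simp add: red_def l R0[OF uR])
    have "\<beta> y z = 0" for y z
    proof (cases "\<alpha>' (red y) = 0")
      case True
      then have "red y \<in> R \<beta>" using red0 KR by (auto simp: K_def)
      then show ?thesis using R0 redb by metis
    next
      case False
      define r where "r = \<alpha>' (red z) / \<alpha>' (red y)"
      have "red z - scale r (red y) \<in> K"
        using red0 False by (simp add: K_def linear_form_simps[OF a(1)] linear_form_simps[OF a(2)] r_def)
      then have "\<beta> (red y) (red z - scale r (red y)) = 0" using KR R0 by blast
      then have "\<beta> (red y) (red z) = 0" by (simp add: l alternating2_self[OF alt])
      then show ?thesis using redb by simp
    qed
    then show False using ne by blast
  qed
  have in_at_most_one: "k \<in> R \<beta> \<and> u \<in> R \<beta>"
    if alt: "alternating2 scale \<beta>" and st: "c \<noteq> d" "u + scale c k \<in> R \<beta>" "u + scale d k \<in> R \<beta>"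
    for \<beta> c d k
  proof -
    note l = linear_form_simps[OF alternating2_right[OF alt]]
    have "\<beta> x k = 0 \<and> \<beta> x u = 0" for x
    proof -
      have 1: "\<beta> x u + c * \<beta> x k = 0" "\<beta> x u + d * \<beta> x k = 0" using st by (auto simp: R_def l)
      have "(c - d) * \<beta> x k = (\<beta> x u + c * \<beta> x k) - (\<beta> x u + d * \<beta> x k)"
        by (simp add: algebra_simps)
      then have "(c - d) * \<beta> x k = 0" using 1 by simp
      then have "\<beta> x k = 0" using st(1) by simp
      then show ?thesis using 1 by simp
    qed
    then show ?thesis by (simp add: R_def)
  qed
  have disjoint: "u + k \<notin> R \<beta>"
    if alt: "alternating2 scale \<beta>" and ne: "\<exists>x y. \<beta> x y \<noteq> 0" and KR: "K \<subseteq> R \<beta>" and k: "k \<in> K" for \<beta> k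
  proof
    assume "u + k \<in> R \<beta>"
    then have "u \<in> R \<beta>" using KR k linear_form_add[OF alternating2_right[OF alt]] by (auto simp: R_def)
    then show False using big[OF alt ne KR] by blast
  qed
  have KRsub: "\<exists>k\<in>K. k \<notin> R \<beta> \<and> k \<notin> R \<beta>'"
    if "\<not> K \<subseteq> R \<beta>" "\<not> K \<subseteq> R \<beta>'"
  proof -
    obtain k k' where k: "k \<in> K" "k \<notin> R \<beta>" and k': "k' \<in> K" "k' \<notin> R \<beta>'" using \<open>\<not> K \<subseteq> R \<beta>\<close> \<open>\<not> K \<subseteq> R \<beta>'\<close> by blast
    have kk: "k + k' \<in> K" using k k' by (simp add: K_def linear_form_simps[OF a(1)] linear_form_simps[OF a(2)])
    have "k + k' \<notin> R \<beta>" if "k' \<in> R \<beta>" using that k(2) by (auto simp: R_def linear_form_simps[OF alternating2_right[OF b(1)]])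
    moreover have "k + k' \<notin> R \<beta>'" if "k \<in> R \<beta>'" using that k'(2) by (auto simp: R_def linear_form_simps[OF alternating2_right[OF b(2)]])
    ultimately show ?thesis using k k' kk by blast
  qed
  have one: "\<exists>k\<in>K. u + k \<notin> R \<beta> \<and> u + k \<notin> R \<beta>'"
    if b: "alternating2 scale \<beta>" "alternating2 scale \<beta>'" "\<exists>x y. \<beta> x y \<noteq> 0" and KR: "K \<subseteq> R \<beta>" "\<not> K \<subseteq> R \<beta>'" for \<beta> \<beta>'
  proof -
    obtain k where k: "k \<in> K" "k \<notin> R \<beta>'" using KR by blast
    have "u + scale 0 k \<notin> R \<beta>' \<or> u + scale 1 k \<notin> R \<beta>'"
      using in_at_most_one[OF b(2), of 0 1 k] k by auto
    then show ?thesis using disjoint[OF b(1,3) KR(1)] Ks[OF k(1)] by blast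
  qed
  have "\<exists>k\<in>K. u + k \<notin> R \<beta> \<and> u + k \<notin> R \<beta>'"
  proof -
    consider "K \<subseteq> R \<beta>" "K \<subseteq> R \<beta>'" | "K \<subseteq> R \<beta>" "\<not> K \<subseteq> R \<beta>'" | "\<not> K \<subseteq> R \<beta>" "K \<subseteq> R \<beta>'"
      | "\<not> K \<subseteq> R \<beta>" "\<not> K \<subseteq> R \<beta>'" by blast
    then show ?thesis
    proof cases
      case 1 then show ?thesis using disjoint[OF b(1,3)] disjoint[OF b(2,4)] K0 by blast
    next
      case 2 then show ?thesis using one[OF b(1,2,3)] by blast
    next
      case 3 then show ?thesis using one[OF b(2,1,4)] by blast
    next
      case 4
      then obtain k where k: "k \<in> K" "k \<notin> R \<beta>" "k \<notin> R \<beta>'" using KRsub by blast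
      have *: "\<not> (u + scale c k \<in> R \<beta> \<and> u + scale d k \<in> R \<beta>)" "\<not> (u + scale c k \<in> R \<beta>' \<and> u + scale d k \<in> R \<beta>')"
        if "c \<noteq> d" for c d
        using in_at_most_one[OF b(1) that] in_at_most_one[OF b(2) that] k by blast+
      have "(0::'a) \<noteq> 1" by simp
      then have "\<exists>c\<in>{0, 1, s}. u + scale c k \<notin> R \<beta> \<and> u + scale c k \<notin> R \<beta>'"
        using * s by blast
      then show ?thesis using Ks[OF k(1)] by blast
    qed
  qed
  then show ?thesis using Ku unfolding R_def by blast
qed

text \<open>With \<open>y\<close> fixed the relation becomes one in two arguments, so \<open>null_rel2_extend\<close> yields a scalar that
  depends on \<open>y\<close> alone. By symmetry the pair \<open>(y, z)\<close> may be read with \<open>y\<close> or with \<open>z\<close> fixed; if the pair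
  determines its scalar, then those of \<open>y\<close> and \<open>z\<close> agree. Two vectors \<open>y\<close>, \<open>y'\<close> are compared
  through a common \<open>z\<close>.\<close>

lemma null_rel3_extend:
  assumes h: "null_rel3 scale h" and P: "Vector_Spaces.linear scale scale P"
    and \<phi>: "alternating3 scale \<phi>" "\<And>x y z. h (P x) (P y) (P z) \<longleftrightarrow> \<phi> x y z = 0"
    and \<psi>: "alternating2 scale \<psi>" "\<And>y z. h e (P y) (P z) \<longleftrightarrow> \<psi> y z = 0"
  shows "\<exists>c. c \<noteq> 0 \<and> (\<forall>x y z. h (e + P x) (P y) (P z) \<longleftrightarrow> \<phi> x y z + c * \<psi> y z = 0)"
proof -
  define C where "C y c \<longleftrightarrow> c \<noteq> 0 \<and> (\<forall>x z. h (e + P x) (P y) (P z) \<longleftrightarrow> \<phi> x y z + c * \<psi> y z = 0)" for y c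
  have ex: "\<exists>c. C y c" for y
  proof -
    have h': "null_rel2 scale (\<lambda>x z. h x (P y) z)"
      using null_rel3_fst[OF h, of "P y"] null_rel3_swap12[OF h] by (simp add: null_rel2_def)
    show ?thesis
      using null_rel2_extend[OF h' P alternating3_snd[OF \<phi>(1)] \<phi>(2) alternating2_right[OF \<psi>(1)] \<psi>(2)]
      unfolding C_def .
  qed
  have eq: "c = d" if yz: "\<psi> y z \<noteq> 0" "\<phi> x y z \<noteq> 0" and c: "C y c" and d: "C z d" for x y z c d
  proof -
    define r where "r = - c * \<psi> y z / \<phi> x y z"
    note l = linear_form_simps[OF alternating2_left[OF alternating3_thd[OF \<phi>(1)]]]
    have 1: "\<phi> (scale r x) y z + c * \<psi> y z = 0" using yz by (simp add: r_def l)
    then have "h (e + P (scale r x)) (P y) (P z)" using c by (auto simp: C_def)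
    then have "h (e + P (scale r x)) (P z) (P y)" using null_rel3_swap23[OF h] by blast
    then have "\<phi> (scale r x) z y + d * \<psi> z y = 0" using d by (auto simp: C_def)
    then have 2: "- \<phi> (scale r x) y z + d * (- \<psi> y z) = 0"
      by (simp only: alternating3_swap23[OF \<phi>(1), of _ z y] alternating2_swap[OF \<psi>(1), of z y])
    have "(c - d) * \<psi> y z
        = (\<phi> (scale r x) y z + c * \<psi> y z) + (- \<phi> (scale r x) y z + d * (- \<psi> y z))"
      by (simp add: algebra_simps)
    also have "\<dots> = 0" using 1 2 by simp
    finally show ?thesis using yz by simp
  qed
  define live where "live y \<longleftrightarrow> (\<exists>z. \<psi> y z \<noteq> 0) \<and> (\<exists>x z. \<phi> x y z \<noteq> 0)" for y
  have irr: "C y c" if d: "C y d" and c: "c \<noteq> 0" and y: "\<not> live y" for y c d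
  proof -
    have "(\<forall>z. \<psi> y z = 0) \<or> (\<forall>x z. \<phi> x y z = 0)" using y unfolding live_def by blast
    then have "\<phi> x y z + d * \<psi> y z = 0 \<longleftrightarrow> \<phi> x y z + c * \<psi> y z = 0" for x z
      using d c unfolding C_def by (elim disjE) simp_all
    then show ?thesis using d c unfolding C_def by blast
  qed
  have "\<exists>c. \<forall>y. C y c"
  proof (cases "\<exists>y. live y")
    case False
    then have "C y 1" for y using ex[of y] irr[of y _ 1] by (metis one_neq_zero)
    then show ?thesis by blast
  next
    case True
    then obtain y0 where y0: "live y0" by blast
    obtain c where c: "C y0 c" using ex by blast
    have "C y c" for y
    proof (cases "live y")
      case False
      then show ?thesis using ex[of y] irr[of y _ c] c unfolding C_def by blast
    next
      case live: True
      obtain d where d: "C y d" using ex by blast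
      have "d = c"
      proof (cases "\<exists>s :: 'a. s \<noteq> 0 \<and> s \<noteq> 1")
        case True
        then obtain s :: 'a where s: "s \<noteq> 0" "s \<noteq> 1" by blast
        have "\<exists>z. \<psi> y0 z \<noteq> 0 \<and> \<psi> y z \<noteq> 0 \<and> (\<exists>x. \<phi> x y0 z \<noteq> 0) \<and> (\<exists>x. \<phi> x y z \<noteq> 0)"
          by (rule pair_nonzero_avoiding[OF alternating2_right[OF \<psi>(1)] alternating2_right[OF \<psi>(1)] _ _
                alternating3_snd[OF \<phi>(1)] alternating3_snd[OF \<phi>(1)] _ _ s])
             (use y0 live in \<open>auto simp: live_def\<close>)
        then obtain z x x' where z: "\<psi> y0 z \<noteq> 0" "\<psi> y z \<noteq> 0" "\<phi> x y0 z \<noteq> 0" "\<phi> x' y z \<noteq> 0" by blast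
        obtain b where b: "C z b" using ex by blast
        show ?thesis using eq[OF z(1,3) c b] eq[OF z(2,4) d b] by simp
      next
        case False
        then show ?thesis using c d unfolding C_def by metis
      qed
      then show ?thesis using d by simp
    qed
    then show ?thesis by blast
  qed
  then show ?thesis unfolding C_def by blast
qed

lemma linear_coordinates:
  assumes "\<And>i. i \<in> S \<Longrightarrow> linear_form scale (l i)"
  shows "Vector_Spaces.linear scale scale (\<lambda>x. \<Sum>i\<in>S. scale (l i x) (e i))"
  unfolding Vector_Spaces.linear_iff
  using vector_space_axioms assms
  by (auto simp: linear_form_simps scale_left_distrib sum.distrib scale_sum_right intro!: sum.cong)

text \<open>Stated for the image of a projection to finitely many coordinates, so that the induction over the
  coordinates takes place inside a single vector space.\<close>

lemma null_rel2_imp_alternating2: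
  assumes h: "null_rel2 scale h" and "finite S" "\<And>i. i \<in> S \<Longrightarrow> linear_form scale (l i)"
  shows "\<exists>\<phi>. alternating2 scale \<phi> \<and>
    (\<forall>x y. h (\<Sum>i\<in>S. scale (l i x) (e i)) (\<Sum>i\<in>S. scale (l i y) (e i)) \<longleftrightarrow> \<phi> x y = 0)"
  using assms(2,3)
proof (induction S)
  case empty
  have "h 0 0" by (rule null_rel2_self[OF h])
  moreover have "alternating2 scale (\<lambda>x y. 0)" by (simp add: alternating2_def linear_form_const_zero)
  ultimately show ?case by (intro exI[of _ "\<lambda>x y. 0"]) simp
next
  case (insert i S)
  define P where "P x = (\<Sum>i\<in>S. scale (l i x) (e i))" for x
  define Q where "Q x = (\<Sum>i\<in>insert i S. scale (l i x) (e i))" for x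
  have P: "Vector_Spaces.linear scale scale P"
    unfolding P_def[abs_def] by (rule linear_coordinates) (use insert.prems in blast)
  have Q: "Vector_Spaces.linear scale scale Q"
    unfolding Q_def[abs_def] by (rule linear_coordinates) (use insert.prems in blast)
  have QP: "Q x = scale (l i x) (e i) + P x" for x
    using insert.hyps by (simp add: P_def Q_def)
  have li: "linear_form scale (l i)" using insert.prems by blast
  obtain \<phi> where \<phi>: "alternating2 scale \<phi>" "\<And>x y. h (P x) (P y) \<longleftrightarrow> \<phi> x y = 0"
    using insert.IH insert.prems unfolding P_def by blast
  obtain f where f: "linear_form scale f" "\<And>y. h (e i) y \<longleftrightarrow> f y = 0"
    using null_rel2_form[OF h] by blast
  define \<psi> where "\<psi> y = f (P y)" for y
  have \<psi>: "linear_form scale \<psi>" "\<And>y. h (e i) (P y) \<longleftrightarrow> \<psi> y = 0"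
    unfolding \<psi>_def using linear_form_comp[OF f(1) P] f(2) by blast+
  obtain c where c: "\<And>x y. h (e i + P x) (P y) \<longleftrightarrow> \<phi> x y + c * \<psi> y = 0"
    using null_rel2_extend[OF h P \<phi> \<psi>] by blast
  define \<Phi> where "\<Phi> x y = \<phi> x y + c * (l i x * \<psi> y - l i y * \<psi> x)" for x y
  note lfs = linear_form_simps[OF li] linear_form_simps[OF \<psi>(1)] linear_form_simps[OF alternating2_left[OF \<phi>(1)]] linear_form_simps[OF alternating2_right[OF \<phi>(1)]]
  have \<Phi>: "alternating2 scale \<Phi>"
    unfolding alternating2_def linear_form_iff \<Phi>_def
    by (auto simp: lfs alternating2_self[OF \<phi>(1)] algebra_simps)
  have "h (Q x) (Q y) \<longleftrightarrow> \<Phi> x y = 0" for x y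
  proof (rule null_rel2_eqI[OF null_rel2_comp[OF h Q] \<Phi> li])
    fix x y assume "l i x = 0" "l i y = 0"
    then show "h (Q x) (Q y) \<longleftrightarrow> \<Phi> x y = 0" by (simp add: QP \<Phi>_def \<phi>(2))
  next
    fix x y assume "l i x = 1" "l i y = 0"
    then show "h (Q x) (Q y) \<longleftrightarrow> \<Phi> x y = 0" by (simp add: QP \<Phi>_def c)
  qed
  then show ?case using \<Phi> unfolding Q_def by blast
qed

lemma null_rel3_imp_alternating3:
  assumes h: "null_rel3 scale h" and "finite S" "\<And>i. i \<in> S \<Longrightarrow> linear_form scale (l i)"
  shows "\<exists>\<phi>. alternating3 scale \<phi> \<and>
    (\<forall>x y z. h (\<Sum>i\<in>S. scale (l i x) (e i)) (\<Sum>i\<in>S. scale (l i y) (e i)) (\<Sum>i\<in>S. scale (l i z) (e i))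
       \<longleftrightarrow> \<phi> x y z = 0)"
  using assms(2,3)
proof (induction S)
  case empty
  have "h 0 0 0" by (rule null_rel2_self[OF null_rel3_fst[OF h]])
  moreover have "alternating3 scale (\<lambda>x y z. 0)"
    by (simp add: alternating3_def alternating2_def linear_form_const_zero)
  ultimately show ?case by (intro exI[of _ "\<lambda>x y z. 0"]) simp
next
  case (insert i S)
  define P where "P x = (\<Sum>i\<in>S. scale (l i x) (e i))" for x
  define Q where "Q x = (\<Sum>i\<in>insert i S. scale (l i x) (e i))" for x
  have P: "Vector_Spaces.linear scale scale P"
    unfolding P_def[abs_def] by (rule linear_coordinates) (use insert.prems in blast)
  have Q: "Vector_Spaces.linear scale scale Q"
    unfolding Q_def[abs_def] by (rule linear_coordinates) (use insert.prems in blast)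
  have QP: "Q x = scale (l i x) (e i) + P x" for x
    using insert.hyps by (simp add: P_def Q_def)
  have li: "linear_form scale (l i)" using insert.prems by blast
  obtain \<phi> where \<phi>: "alternating3 scale \<phi>" "\<And>x y z. h (P x) (P y) (P z) \<longleftrightarrow> \<phi> x y z = 0"
    using insert.IH insert.prems unfolding P_def by blast
  obtain \<psi> where \<psi>: "alternating2 scale \<psi>" "\<And>y z. h (e i) (P y) (P z) \<longleftrightarrow> \<psi> y z = 0"
    using null_rel2_imp_alternating2[OF null_rel3_fst[OF h] insert.hyps(1), of l "e i" e] insert.prems
    unfolding P_def by blast
  obtain c where c: "\<And>x y z. h (e i + P x) (P y) (P z) \<longleftrightarrow> \<phi> x y z + c * \<psi> y z = 0"
    using null_rel3_extend[OF h P \<phi> \<psi>] by blast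
  define \<Phi> where
    "\<Phi> x y z = \<phi> x y z + c * (l i x * \<psi> y z - l i y * \<psi> x z + l i z * \<psi> x y)" for x y z
  note lfs = linear_form_simps[OF li] linear_form_simps[OF alternating2_left[OF \<psi>(1)]] linear_form_simps[OF alternating2_right[OF \<psi>(1)]]
    linear_form_simps[OF alternating2_left[OF alternating3_fst[OF \<phi>(1)]]] linear_form_simps[OF alternating2_left[OF alternating3_thd[OF \<phi>(1)]]]
    linear_form_simps[OF alternating2_right[OF alternating3_fst[OF \<phi>(1)]]]
  have "alternating2 scale (\<Phi> x)" for x
    unfolding alternating2_def linear_form_iff \<Phi>_def
    by (auto simp: lfs alternating2_self[OF alternating3_fst[OF \<phi>(1)]] alternating2_self[OF \<psi>(1)] algebra_simps)
  moreover have "alternating2 scale (\<lambda>x y. \<Phi> x y z)" for z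
    unfolding alternating2_def linear_form_iff \<Phi>_def
    by (auto simp: lfs alternating2_self[OF alternating3_thd[OF \<phi>(1)]] alternating2_self[OF \<psi>(1)] algebra_simps)
  ultimately have \<Phi>: "alternating3 scale \<Phi>" by (simp add: alternating3_def)
  have "h (Q x) (Q y) (Q z) \<longleftrightarrow> \<Phi> x y z = 0" for x y z
  proof (rule null_rel3_eqI[OF null_rel3_comp[OF h Q] \<Phi> li])
    fix x y z assume "l i x = 0" "l i y = 0" "l i z = 0"
    then show "h (Q x) (Q y) (Q z) \<longleftrightarrow> \<Phi> x y z = 0" by (simp add: QP \<Phi>_def \<phi>(2))
  next
    fix x y z assume "l i x = 1" "l i y = 0" "l i z = 0"
    then show "h (Q x) (Q y) (Q z) \<longleftrightarrow> \<Phi> x y z = 0" by (simp add: QP \<Phi>_def c)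
  qed
  then show ?case using \<Phi> unfolding Q_def by blast
qed

text \<open>Fix \<open>v\<close> outside \<open>S\<close>; the form maps \<open>u\<close> to the unique \<open>t\<close> with \<open>u - t v \<in> S\<close>.\<close>

lemma kernel_of_linear_form:
  assumes S: "subspace S" and codim: "\<And>u v. v \<notin> S \<Longrightarrow> \<exists>t. u - scale t v \<in> S"
  shows "\<exists>f. linear_form scale f \<and> (\<forall>x. x \<in> S \<longleftrightarrow> f x = 0)"
proof (cases "S = UNIV")
  case True
  then show ?thesis using linear_form_const_zero by blast
next
  case False
  then obtain v where v: "v \<notin> S" by blast
  have uniq: "s = t" if "u - scale s v \<in> S" "u - scale t v \<in> S" for u s t
  proof (rule ccontr)
    assume "s \<noteq> t"
    have "scale (t - s) v \<in> S"
      using subspace_diff[OF S that] by (simp add: scale_left_diff_distrib)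
    then have "scale (1 / (t - s)) (scale (t - s) v) \<in> S" by (rule subspace_scale[OF S])
    then show False using v \<open>s \<noteq> t\<close> by simp
  qed
  define f where "f u = (THE t. u - scale t v \<in> S)" for u
  have f_eq: "f u = t" if "u - scale t v \<in> S" for u t
    unfolding f_def using that uniq by blast
  have f: "u - scale (f u) v \<in> S" for u
    using codim[OF v, of u] f_eq by metis
  have "linear_form scale f"
    unfolding linear_form_iff
  proof (intro conjI allI)
    fix x y c
    show "f (x + y) = f x + f y"
      by (rule f_eq) (use subspace_add[OF S f[of x] f[of y]] in \<open>simp add: algebra_simps\<close>)
    show "f (scale c x) = c * f x"
      by (rule f_eq) (use subspace_scale[OF S f[of x], of c] in \<open>simp add: algebra_simps\<close>)
  qed
  moreover have "x \<in> S \<longleftrightarrow> f x = 0" for x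
    using f[of x] f_eq[of x 0] by auto
  ultimately show ?thesis by blast
qed

end

section \<open>Pfaffians and their derivatives\<close>

text \<open>Expansion along a first row with entries \<open>a z\<close>: up to alternating signs, the sum over all positions in
  the list of \<open>a\<close> at the entry there times \<open>f\<close> on the remaining list. If \<open>f\<close> is multilinear and
  alternating on lists of each length, this is the exterior product of \<open>a\<close> with \<open>f\<close>.\<close>

fun contract :: "('v \<Rightarrow> 'k::comm_ring_1) \<Rightarrow> ('v list \<Rightarrow> 'k) \<Rightarrow> 'v list \<Rightarrow> 'k" where
  "contract a f [] = 0"
| "contract a f (z # zs) = a z * f zs - contract a (\<lambda>l. f (z # l)) zs"

text \<open>The Pfaffian of the Gram matrix of a list of \<open>2 n\<close> vectors, by expansion along the first row. On lists
  of any other length the value is 0, which makes the function alternating and multilinear on all lists.\<close>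

primrec pfaffian :: "('v \<Rightarrow> 'v \<Rightarrow> 'k::comm_ring_1) \<Rightarrow> nat \<Rightarrow> 'v list \<Rightarrow> 'k" where
  "pfaffian A 0 l = (if l = [] then 1 else 0)"
| "pfaffian A (Suc n) l = (case l of [] \<Rightarrow> 0 | x # xs \<Rightarrow> contract (A x) (pfaffian A n) xs)"

text \<open>The coefficient of \<open>t\<close> in the Pfaffian of \<open>A + t M\<close>.\<close>

primrec dpfaffian ::
  "('v \<Rightarrow> 'v \<Rightarrow> 'k::comm_ring_1) \<Rightarrow> ('v \<Rightarrow> 'v \<Rightarrow> 'k) \<Rightarrow> nat \<Rightarrow> 'v list \<Rightarrow> 'k" where
  "dpfaffian A M 0 l = 0"
| "dpfaffian A M (Suc n) l = (case l of [] \<Rightarrow> 0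
     | x # xs \<Rightarrow> contract (M x) (pfaffian A n) xs + contract (A x) (dpfaffian A M n) xs)"

lemma contract_add: "contract a (\<lambda>l. f l + g l) l = contract a f l + contract a g l"
  by (induction l arbitrary: f g) (simp_all add: algebra_simps)

lemma contract_cmult: "contract a (\<lambda>l. c * f l) l = c * contract a f l"
  by (induction l arbitrary: f) (simp_all add: algebra_simps)

lemma contract_diff: "contract a (\<lambda>l. f l - g l) l = contract a f l - contract a g l"
  by (induction l arbitrary: f g) (simp_all add: algebra_simps)

lemma contract_zero: "contract a (\<lambda>l. 0) l = 0"
  by (induction l) simp_all

lemma contract_form_add: "contract (\<lambda>z. a z + b z) f l = contract a f l + contract b f l"
  by (induction l arbitrary: f) (simp_all add: algebra_simps)

lemma contract_form_cmult: "contract (\<lambda>z. c * a z) f l = c * contract a f l"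
  by (induction l arbitrary: f) (simp_all add: algebra_simps)

lemma contract_vanish: "(\<And>z. z \<in> set l \<Longrightarrow> a z = 0) \<Longrightarrow> contract a f l = 0"
  by (induction l arbitrary: f) simp_all

text \<open>Exterior multiplication by linear forms is anticommutative.\<close>

lemma contract_anticommute:
  "contract a (contract b f) l + contract b (contract a f) l = 0"
proof (induction l arbitrary: f)
  case (Cons z zs)
  let ?f = "\<lambda>l. f (z # l)"
  have "contract a (contract b f) (z # zs) = a z * contract b f zs - (b z * contract a f zs - contract a (contract b ?f) zs)"
    "contract b (contract a f) (z # zs) = b z * contract a f zs - (a z * contract b f zs - contract b (contract a ?f) zs)"
    by (simp_all only: contract.simps contract_diff contract_cmult)
  note expand = this
  have "contract a (contract b f) (z # zs) + contract b (contract a f) (z # zs)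
      = contract a (contract b ?f) zs + contract b (contract a ?f) zs"
    unfolding expand by (simp add: algebra_simps)
  then show ?case by (simp only: Cons.IH)
qed simp

text \<open>In characteristic 2 this does not follow from anticommutativity.\<close>

lemma contract_twice: "contract a (contract a f) l = 0"
proof (induction l arbitrary: f)
  case (Cons z zs)
  then show ?case by (simp add: contract_diff contract_cmult)
qed simp

text \<open>Only adjacent equal entries are considered, which is what an induction along the list can use; for
  multilinear functions equal entries at other positions follow.\<close>

definition list_alternating :: "('v list \<Rightarrow> 'k::comm_ring_1) \<Rightarrow> bool" where
  "list_alternating f \<longleftrightarrow> (\<forall>us x vs. f (us @ x # x # vs) = 0)"

definition list_multilinear ::
  "('k::field \<Rightarrow> 'v::ab_group_add \<Rightarrow> 'v) \<Rightarrow> ('v list \<Rightarrow> 'k) \<Rightarrow> bool" where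
  "list_multilinear scl f \<longleftrightarrow> (\<forall>us vs. linear_form scl (\<lambda>x. f (us @ x # vs)))"

lemma list_alternating_Cons: "list_alternating f \<Longrightarrow> list_alternating (\<lambda>l. f (u # l))"
  unfolding list_alternating_def by (metis append_Cons)

lemma list_multilinear_Cons:
  assumes "list_multilinear scl f"
  shows "list_multilinear scl (\<lambda>l. f (u # l))"
  unfolding list_multilinear_def
proof (intro allI)
  fix us vs
  show "linear_form scl (\<lambda>x. f (u # us @ x # vs))"
    using assms[unfolded list_multilinear_def, rule_format, of "u # us" vs] by simp
qed

lemma list_alternating_contract:
  assumes "list_alternating f"
  shows "list_alternating (contract a f)"
proof -
  have "contract a f (us @ x # x # vs) = 0" for us x vs
    using assms
  proof (induction us arbitrary: f)
    case Nil
    have "f (x # x # l) = 0" for l using Nil unfolding list_alternating_def by (metis append_Nil)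
    then show ?case by (simp add: contract_zero)
  next
    case (Cons u us)
    have "f (us @ x # x # vs) = 0" using Cons.prems by (simp add: list_alternating_def)
    then show ?case using Cons.IH[OF list_alternating_Cons[OF Cons.prems]] by simp
  qed
  then show ?thesis by (simp add: list_alternating_def)
qed

context vector_space
begin

lemma list_multilinear_contract:
  assumes a: "linear_form scale a" and f: "list_multilinear scale f"
  shows "list_multilinear scale (contract a f)"
proof -
  have "linear_form scale (\<lambda>x. contract a f (us @ x # vs))" for us vs
    using f
  proof (induction us arbitrary: f)
    case Nil
    have l: "linear_form scale (\<lambda>x. f (x # l))" for l
      using Nil[unfolded list_multilinear_def, rule_format, of "[]" l] by simp
    have "contract a (\<lambda>l. f ((x + y) # l)) vs = contract a (\<lambda>l. f (x # l)) vs + contract a (\<lambda>l. f (y # l)) vs"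
      "contract a (\<lambda>l. f (scale c x # l)) vs = c * contract a (\<lambda>l. f (x # l)) vs" for x y c
      by (simp_all only: linear_form_add[OF l] linear_form_scale[OF l] contract_add contract_cmult)
    then show ?case
      unfolding linear_form_iff append_Nil contract.simps linear_form_add[OF a] linear_form_scale[OF a]
      by (simp only: ring_distribs mult.assoc add_diff_add simp_thms)
  next
    case (Cons u us)
    have l: "linear_form scale (\<lambda>x. f (us @ x # vs))" using Cons.prems by (simp add: list_multilinear_def)
    note IH = Cons.IH[OF list_multilinear_Cons[OF Cons.prems]]
    show ?case
      unfolding linear_form_iff
      by (simp add: linear_form_add[OF l] linear_form_scale[OF l] linear_form_add[OF IH] linear_form_scale[OF IH] algebra_simps)
  qed
  then show ?thesis by (simp add: list_multilinear_def)
qed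

lemma list_multilinear_add:
  "list_multilinear scale f \<Longrightarrow> list_multilinear scale g \<Longrightarrow> list_multilinear scale (\<lambda>l. f l + g l)"
  by (simp add: list_multilinear_def linear_form_plus)

lemma list_multilinear_contract_head:
  assumes A: "alternating2 scale A" and f: "list_multilinear scale f"
  shows "list_multilinear scale (\<lambda>l. case l of [] \<Rightarrow> 0 | x # xs \<Rightarrow> contract (A x) f xs)"
  unfolding list_multilinear_def
proof (intro allI)
  fix us vs
  note Al = alternating2_left[OF A]
  show "linear_form scale (\<lambda>x. case us @ x # vs of [] \<Rightarrow> 0 | x # xs \<Rightarrow> contract (A x) f xs)"
  proof (cases us)
    case Nil
    have "A (x + y) = (\<lambda>z. A x z + A y z)" "A (scale c x) = (\<lambda>z. c * A x z)" for x y c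
      by (auto simp: linear_form_add[OF Al] linear_form_scale[OF Al])
    then show ?thesis
      unfolding linear_form_iff using Nil by (simp add: contract_form_add contract_form_cmult)
  next
    case (Cons u us')
    then show ?thesis
      using list_multilinear_contract[OF alternating2_right[OF A] f] by (simp add: list_multilinear_def)
  qed
qed

lemma pfaffian_Suc_fun:
  "pfaffian A (Suc n) = (\<lambda>l. case l of [] \<Rightarrow> 0 | x # xs \<Rightarrow> contract (A x) (pfaffian A n) xs)"
  by (rule ext) simp

lemma dpfaffian_Suc_fun:
  "dpfaffian A M (Suc n) = (\<lambda>l. (case l of [] \<Rightarrow> 0 | x # xs \<Rightarrow> contract (M x) (pfaffian A n) xs)
     + (case l of [] \<Rightarrow> 0 | x # xs \<Rightarrow> contract (A x) (dpfaffian A M n) xs))"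
  by (rule ext) (simp split: list.split)

lemma list_multilinear_pfaffian:
  assumes "alternating2 scale A"
  shows "list_multilinear scale (pfaffian A n)"
proof (induction n)
  case 0
  show ?case by (simp add: list_multilinear_def linear_form_const_zero)
next
  case (Suc n)
  then show ?case
    unfolding pfaffian_Suc_fun by (rule list_multilinear_contract_head[OF assms])
qed

lemma list_multilinear_dpfaffian:
  assumes "alternating2 scale A" "alternating2 scale M"
  shows "list_multilinear scale (dpfaffian A M n)"
proof (induction n)
  case 0
  show ?case by (simp add: list_multilinear_def linear_form_const_zero)
next
  case (Suc n)
  then show ?case
    unfolding dpfaffian_Suc_fun
    by (intro list_multilinear_add list_multilinear_contract_head assms list_multilinear_pfaffian)
qed

text \<open>For two equal vectors at the head the expansion leaves \<open>A x x\<close>, which is zero, and a double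
  contraction with the form \<open>A x\<close>.\<close>

lemma list_alternating_pfaffian:
  assumes A: "alternating2 scale A"
  shows "list_alternating (pfaffian A n)"
proof (induction n)
  case 0
  show ?case by (simp add: list_alternating_def)
next
  case (Suc n)
  have "pfaffian A (Suc n) (us @ x # x # vs) = 0" for us x vs
  proof (cases us)
    case Nil
    have "contract (A x) (\<lambda>l. pfaffian A n (x # l)) vs = 0"
      by (cases n) (simp_all add: contract_zero contract_twice)
    then show ?thesis using Nil by (simp add: alternating2_self[OF A])
  next
    case (Cons u us')
    then show ?thesis using list_alternating_contract[OF Suc] by (simp add: list_alternating_def)
  qed
  then show ?case by (simp add: list_alternating_def)
qed

text \<open>Here the two mixed contractions, with \<open>M x\<close> and \<open>A x\<close> in either order, cancel each other.\<close>

lemma list_alternating_dpfaffian: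
  assumes A: "alternating2 scale A" and M: "alternating2 scale M"
  shows "list_alternating (dpfaffian A M n)"
proof (induction n)
  case 0
  show ?case by (simp add: list_alternating_def)
next
  case (Suc n)
  have "dpfaffian A M (Suc n) (us @ x # x # vs) = 0" for us x vs
  proof (cases us)
    case Nil
    have "contract (M x) (\<lambda>l. pfaffian A n (x # l)) vs + contract (A x) (\<lambda>l. dpfaffian A M n (x # l)) vs = 0"
    proof (cases n)
      case (Suc m)
      then show ?thesis
        using contract_anticommute[of "M x" "A x" "pfaffian A m" vs]
        by (simp add: contract_add contract_twice)
    qed (simp add: contract_zero)
    then show ?thesis using Nil by (simp add: alternating2_self[OF A] alternating2_self[OF M] add_eq_0_iff)
  next
    case (Cons u us')
    then show ?thesis
      using list_alternating_contract[OF Suc] list_alternating_contract[OF list_alternating_pfaffian[OF A]]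
      by (simp add: list_alternating_def)
  qed
  then show ?case by (simp add: list_alternating_def)
qed

lemma alternating_multilinear_swap:
  assumes "list_alternating f" "list_multilinear scale f"
  shows "f (us @ x # y # vs) = - f (us @ y # x # vs)"
proof -
  have alt: "f (us @ x # x # vs) = 0" for x using assms(1) by (simp add: list_alternating_def)
  have l1: "linear_form scale (\<lambda>x. f (us @ x # y # vs))" for y
    using assms(2) by (simp add: list_multilinear_def)
  have l2: "linear_form scale (\<lambda>y. f (us @ x # y # vs))" for x
    using assms(2)[unfolded list_multilinear_def, rule_format, of "us @ [x]" vs] by simp
  have "f (us @ x # y # vs) + f (us @ y # x # vs)
      = (f (us @ x # x # vs) + f (us @ x # y # vs)) + (f (us @ y # x # vs) + f (us @ y # y # vs))"
    by (simp add: alt)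
  also have "\<dots> = f (us @ x # (x + y) # vs) + f (us @ y # (x + y) # vs)" by (simp only: linear_form_add[OF l2])
  also have "\<dots> = f (us @ (x + y) # (x + y) # vs)" by (simp only: linear_form_add[OF l1])
  finally show ?thesis by (simp add: alt eq_neg_iff_add_eq_0)
qed

lemma alternating_multilinear_move:
  assumes f: "list_alternating f" "list_multilinear scale f"
  shows "f (us @ x # vs @ ws) = 0 \<longleftrightarrow> f (us @ vs @ x # ws) = 0"
proof (induction vs arbitrary: us)
  case (Cons v vs)
  have "f (us @ x # (v # vs) @ ws) = - f ((us @ [v]) @ x # vs @ ws)"
    using alternating_multilinear_swap[OF f, of us x v "vs @ ws"] by simp
  then show ?case using Cons.IH[of "us @ [v]"] by simp
qed simp

lemma alternating_multilinear_perm: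
  assumes f: "list_alternating f" "list_multilinear scale f" and "mset xs = mset ys"
  shows "f (us @ xs) = 0 \<longleftrightarrow> f (us @ ys) = 0"
  using assms(3)
proof (induction xs arbitrary: us ys)
  case (Cons x xs)
  then have "x \<in> set ys" by (metis list.set_intros(1) mset_eq_setD)
  then obtain as bs where ys: "ys = as @ x # bs" by (meson split_list)
  have "f (us @ ys) = 0 \<longleftrightarrow> f (us @ x # as @ bs) = 0"
    unfolding ys using alternating_multilinear_move[OF f, of us x as bs] by simp
  also have "\<dots> \<longleftrightarrow> f ((us @ [x]) @ as @ bs) = 0" by simp
  also have "\<dots> \<longleftrightarrow> f ((us @ [x]) @ xs) = 0"
    using Cons.IH[of "as @ bs" "us @ [x]"] Cons.prems ys by simp
  finally show ?case by simp
qed simp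

text \<open>A change of basis multiplies \<open>f\<close> by a determinant; this lemma extracts the consequence that the vanishing of \<open>f\<close> on one basis implies its vanishing everywhere. By linearity in each slot only
  lists of basis vectors matter; such a list repeats an entry or is a permutation of the basis.\<close>

lemma alternating_multilinear_vanish:
  assumes f: "list_alternating f" "list_multilinear scale f"
    and es: "distinct es" "span (set es) = UNIV" "f es = 0" and len: "length vs = length es"
  shows "f vs = 0"
proof -
  have basis: "f vs = 0" if "set vs \<subseteq> set es" "length vs = length es" for vs
  proof (cases "distinct vs")
    case True
    have "set vs = set es"
      by (rule card_subset_eq) (use that True es(1) in \<open>simp_all add: distinct_card\<close>)
    then have "mset vs = mset es" using True es(1) set_eq_iff_mset_eq_distinct by blast
    then show ?thesis using alternating_multilinear_perm[OF f, of vs es "[]"] es(3) by simp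
  next
    case False
    then obtain as x bs cs where vs: "vs = as @ x # bs @ x # cs"
      using not_distinct_decomp[of vs] by auto
    have "f (as @ bs @ x # x # cs) = 0"
      using f(1)[unfolded list_alternating_def, rule_format, of "as @ bs" x cs] by simp
    then show ?thesis
      using alternating_multilinear_move[OF f, of as x bs "x # cs"] unfolding vs by blast
  qed
  have "f (us @ vs) = 0" if "set us \<subseteq> set es" "length (us @ vs) = length es" for us
    using that
  proof (induction vs arbitrary: us)
    case Nil
    then show ?case using basis[of us] by simp
  next
    case (Cons v vs)
    have l: "linear_form scale (\<lambda>x. f (us @ x # vs))" using f(2) by (simp add: list_multilinear_def)
    have "subspace {x. f (us @ x # vs) = 0}"
      by (rule subspaceI) (simp_all add: linear_form_zero[OF l] linear_form_add[OF l] linear_form_scale[OF l])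
    moreover have "set es \<subseteq> {x. f (us @ x # vs) = 0}"
    proof
      fix x assume "x \<in> set es"
      then have "f ((us @ [x]) @ vs) = 0" using Cons.prems by (intro Cons.IH) auto
      then show "x \<in> {x. f (us @ x # vs) = 0}" by simp
    qed
    ultimately have "span (set es) \<subseteq> {x. f (us @ x # vs) = 0}" by (rule span_minimal[rotated])
    then show ?case using es(2) by auto
  qed
  from this[of "[]"] show ?thesis using len by simp
qed

end

section \<open>Hyperbolic families\<close>

text \<open>The list consists of mutually orthogonal hyperbolic pairs \<open>a, b\<close> with \<open>A a b = 1\<close>.\<close>

fun hyperbolic :: "('v \<Rightarrow> 'v \<Rightarrow> 'k::comm_ring_1) \<Rightarrow> 'v list \<Rightarrow> bool" where
  "hyperbolic A [] \<longleftrightarrow> True"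
| "hyperbolic A [a] \<longleftrightarrow> False"
| "hyperbolic A (a # b # l) \<longleftrightarrow> A a b = 1 \<and> (\<forall>z\<in>set l. A a z = 0 \<and> A b z = 0) \<and> hyperbolic A l"

lemma even_length_hyperbolic: "hyperbolic A l \<Longrightarrow> even (length l)"
  by (induction A l rule: hyperbolic.induct) auto

text \<open>In the expansion along \<open>a\<close> only the partner \<open>b\<close> contributes.\<close>

lemma pfaffian_hyperbolic: "hyperbolic A l \<Longrightarrow> length l = 2 * n \<Longrightarrow> pfaffian A n l = 1"
proof (induction A l arbitrary: n rule: hyperbolic.induct)
  case (3 A a b l)
  then obtain m where n: "n = Suc m" by (cases n) auto
  have "contract (A a) (\<lambda>l. pfaffian A m (b # l)) l = 0"
    by (rule contract_vanish) (use "3.prems" in simp)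
  then show ?case using 3 n by simp
qed auto

lemma pfaffian_radical: "A w = (\<lambda>z. 0) \<Longrightarrow> pfaffian A n (w # l) = 0"
  by (cases n) (simp_all add: contract_vanish)

text \<open>The coefficient of \<open>t\<close> loses all terms in which \<open>w\<close> or \<open>u\<close> is paired through \<open>A\<close>, and only the pairing
  of \<open>w\<close> with \<open>u\<close> through \<open>M\<close> remains.\<close>

lemma dpfaffian_radical:
  assumes "A w = (\<lambda>z. 0)" "A u = (\<lambda>z. 0)"
  shows "dpfaffian A M (Suc n) (w # u # l) = M w u * pfaffian A n l"
  by (simp add: assms(1) pfaffian_radical[of A u, OF assms(2)] contract_vanish contract_zero)

context vector_space
begin

text \<open>The form is nondegenerate on the span of a hyperbolic family, so the span has an orthogonal
  complement. The correction term is computed pair by pair.\<close>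

lemma hyperbolic_projection:
  assumes A: "alternating2 scale A" and "hyperbolic A l"
  shows "\<exists>w\<in>span (set l). \<forall>z\<in>set l. A z (v - w) = 0"
  using assms(2)
proof (induction l arbitrary: v rule: induct_list012)
  case (3 a b l)
  note lin = linear_form_simps[OF alternating2_right[OF A]]
  define v1 where "v1 = v - scale (- A b v) a - scale (A a v) b"
  obtain w where w: "w \<in> span (set l)" "\<And>z. z \<in> set l \<Longrightarrow> A z (v1 - w) = 0"
    using "3.IH"(1)[of v1] "3.prems" by auto
  have ab: "A a b = 1" "A b a = - 1" using "3.prems" alternating2_swap[OF A, of b a] by simp_all
  have "span (set l) \<subseteq> {z. A c z = 0}" if "c = a \<or> c = b" for c
    by (rule span_minimal, use "3.prems" that in force)
       (rule subspaceI, simp_all add: lin)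
  then have abw: "A a w = 0" "A b w = 0" using w(1) by blast+
  define w' where "w' = scale (- A b v) a + scale (A a v) b + w"
  have vw: "v - w' = v1 - w" by (simp add: w'_def v1_def algebra_simps)
  have sub: "span (set l) \<subseteq> span (set (a # b # l))" by (rule span_mono) auto
  have "w' \<in> span (set (a # b # l))"
    unfolding w'_def using w(1) sub by (intro span_add span_scale) (auto intro: span_base)
  moreover have "A z (v - w') = 0" if "z \<in> set (a # b # l)" for z
    unfolding vw using that w(2) abw
    by (auto simp: v1_def lin ab alternating2_self[OF A])
  ultimately show ?case by blast
qed (auto intro: span_zero)

text \<open>Project \<open>v\<close> to the orthogonal complement of the family; this does not change \<open>A u v\<close>.\<close>

lemma hyperbolic_extend:
  assumes A: "alternating2 scale A" and l: "hyperbolic A l"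
    and u: "\<And>z. z \<in> set l \<Longrightarrow> A z u = 0" and v: "A u v \<noteq> 0"
  shows "\<exists>a b. hyperbolic A (a # b # l)"
proof -
  note lin = linear_form_simps[OF alternating2_right[OF A]]
  have anti: "A x z = 0" if "A z x = 0" for x z using alternating2_swap[OF A, of x z] that by simp
  obtain w where w: "w \<in> span (set l)" "\<And>z. z \<in> set l \<Longrightarrow> A z (v - w) = 0"
    using hyperbolic_projection[OF A l] by blast
  have "span (set l) \<subseteq> {z. A u z = 0}"
    by (rule span_minimal, use u anti in blast) (rule subspaceI, simp_all add: lin)
  then have uw: "A u w = 0" using w(1) by blast
  define b where "b = scale (1 / A u v) (v - w)"
  have "A u b = 1" using v by (simp add: b_def lin uw)
  moreover have "A u z = 0 \<and> A b z = 0" if "z \<in> set l" for z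
    using u[OF that] w(2)[OF that] anti by (auto simp: b_def lin)
  ultimately have "hyperbolic A (u # b # l)" using l by simp
  then show ?thesis by blast
qed

end

section \<open>Homogeneous forms\<close>

text \<open>Being a form of degree \<open>d\<close> as a function; the polynomial need not be unique over a finite field.\<close>

definition homogeneous_form :: "nat \<Rightarrow> ('k::field ^ 'n::finite \<Rightarrow> 'k) \<Rightarrow> bool" where
  "homogeneous_form d g \<longleftrightarrow> (\<exists>f. mpoly_homogeneous d f \<and> (\<forall>x. mpoly_eval f x = g x))"

lemma mpoly_eval_superset:
  assumes "finite S" "Poly_Mapping.keys f \<subseteq> S"
  shows "mpoly_eval f x =
    (\<Sum>m\<in>S. Poly_Mapping.lookup f m * (\<Prod>i\<in>UNIV. x $ i ^ Poly_Mapping.lookup m i))"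
  unfolding mpoly_eval_def
  by (rule sum.mono_neutral_left) (use assms in \<open>auto simp: in_keys_iff\<close>)

lemma homogeneous_form_zero: "homogeneous_form d (\<lambda>x. 0)"
  unfolding homogeneous_form_def
  by (rule exI[of _ 0]) (simp add: mpoly_homogeneous_def mpoly_eval_def)

lemma homogeneous_form_add:
  assumes "homogeneous_form d g" "homogeneous_form d h"
  shows "homogeneous_form d (\<lambda>x. g x + h x)"
proof -
  obtain p q where p: "mpoly_homogeneous d p" "\<And>x. mpoly_eval p x = g x"
    and q: "mpoly_homogeneous d q" "\<And>x. mpoly_eval q x = h x"
    using assms unfolding homogeneous_form_def by blast
  let ?S = "Poly_Mapping.keys p \<union> Poly_Mapping.keys q"
  have sub: "Poly_Mapping.keys (p + q) \<subseteq> ?S" by (rule keys_add)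
  have "mpoly_homogeneous d (p + q)"
    using p(1) q(1) sub unfolding mpoly_homogeneous_def by blast
  moreover have "mpoly_eval (p + q) x = g x + h x" for x
  proof -
    have "mpoly_eval (p + q) x = mpoly_eval p x + mpoly_eval q x"
      using sub by (simp add: mpoly_eval_superset[of ?S] lookup_add algebra_simps sum.distrib)
    then show ?thesis by (simp add: p(2) q(2))
  qed
  ultimately show ?thesis unfolding homogeneous_form_def by blast
qed

lemma homogeneous_form_sum:
  "(\<And>i. i \<in> I \<Longrightarrow> homogeneous_form d (g i)) \<Longrightarrow> homogeneous_form d (\<lambda>x. \<Sum>i\<in>I. g i x)"
  by (induction I rule: infinite_finite_induct)
    (simp_all add: homogeneous_form_zero homogeneous_form_add)

lemma homogeneous_form_monomial:
  fixes m :: "'n::finite \<Rightarrow>\<^sub>0 nat" and c :: "'k::field"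
  assumes "(\<Sum>i\<in>UNIV. Poly_Mapping.lookup m i) = d"
  shows "homogeneous_form d (\<lambda>x :: 'k ^ 'n. c * (\<Prod>i\<in>UNIV. x $ i ^ Poly_Mapping.lookup m i))"
  unfolding homogeneous_form_def
proof (intro exI conjI allI)
  show "mpoly_homogeneous d (Poly_Mapping.single m c)"
    using assms by (simp add: mpoly_homogeneous_def)
  fix x :: "'k ^ 'n"
  show "mpoly_eval (Poly_Mapping.single m c) x = c * (\<Prod>i\<in>UNIV. x $ i ^ Poly_Mapping.lookup m i)"
    by (simp add: mpoly_eval_superset[of "{m}"])
qed

lemma homogeneous_form_const: "homogeneous_form 0 (\<lambda>x. c)"
  using homogeneous_form_monomial[of 0 0 c] by simp

lemma homogeneous_form_times_coordinate:
  assumes "homogeneous_form d g"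
  shows "homogeneous_form (Suc d) (\<lambda>x. c * x $ j * g x)"
proof -
  obtain p where p: "mpoly_homogeneous d p" "\<And>x. mpoly_eval p x = g x"
    using assms unfolding homogeneous_form_def by blast
  let ?e = "Poly_Mapping.single j (1 :: nat)"
  have shift: "(\<Prod>i\<in>UNIV. x $ i ^ Poly_Mapping.lookup (m + ?e) i)
      = x $ j * (\<Prod>i\<in>UNIV. x $ i ^ Poly_Mapping.lookup m i)" for x :: "'a ^ 'b" and m
  proof -
    have "(\<Prod>i\<in>UNIV. x $ i ^ Poly_Mapping.lookup (m + ?e) i)
        = (\<Prod>i\<in>UNIV. x $ i ^ Poly_Mapping.lookup m i * (if i = j then x $ j else 1))"
      by (rule prod.cong) (auto simp: lookup_add lookup_single when_def)
    then show ?thesis by (simp add: prod.distrib)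
  qed
  have deg: "(\<Sum>i\<in>UNIV. Poly_Mapping.lookup (m + ?e) i) = Suc d" if "m \<in> Poly_Mapping.keys p" for m
  proof -
    have "(\<Sum>i\<in>UNIV. Poly_Mapping.lookup (m + ?e) i)
        = (\<Sum>i\<in>UNIV. Poly_Mapping.lookup m i + (if i = j then 1 else 0))"
      by (rule sum.cong) (auto simp: lookup_add lookup_single when_def)
    then show ?thesis using p(1) that by (simp add: sum.distrib mpoly_homogeneous_def)
  qed
  have "homogeneous_form (Suc d) (\<lambda>x. \<Sum>m\<in>Poly_Mapping.keys p.
      (c * Poly_Mapping.lookup p m) * (\<Prod>i\<in>UNIV. x $ i ^ Poly_Mapping.lookup (m + ?e) i))"
    by (intro homogeneous_form_sum homogeneous_form_monomial deg)
  also have "(\<lambda>x. \<Sum>m\<in>Poly_Mapping.keys p.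
      (c * Poly_Mapping.lookup p m) * (\<Prod>i\<in>UNIV. x $ i ^ Poly_Mapping.lookup (m + ?e) i))
      = (\<lambda>x. c * x $ j * g x)"
    by (rule ext) (simp only: p(2)[symmetric] mpoly_eval_def shift sum_distrib_left mult_ac)
  finally show ?thesis .
qed

lemma linear_form_coordinates:
  assumes "linear_form (*s) a"
  shows "a w = (\<Sum>j\<in>UNIV. a (axis j 1) * w $ j)"
proof -
  have "a w = a (\<Sum>j\<in>UNIV. w $ j *s axis j 1)" by (simp only: basis_expansion)
  also have "\<dots> = (\<Sum>j\<in>UNIV. a (w $ j *s axis j 1))"
    by (rule vec.linear_form_sum[OF assms])
  finally show ?thesis by (simp add: vec.linear_form_scale[OF assms] mult.commute)
qed

lemma homogeneous_form_times_linear: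
  assumes a: "linear_form (*s) a" and g: "homogeneous_form d g"
  shows "homogeneous_form (Suc d) (\<lambda>w. a w * g w)"
proof -
  have "homogeneous_form (Suc d) (\<lambda>w. \<Sum>j\<in>UNIV. a (axis j 1) * w $ j * g w)"
    by (intro homogeneous_form_sum homogeneous_form_times_coordinate g)
  also have "(\<lambda>w. \<Sum>j\<in>UNIV. a (axis j 1) * w $ j * g w) = (\<lambda>w. a w * g w)"
    by (rule ext) (simp only: linear_form_coordinates[OF a, symmetric] sum_distrib_right[symmetric])
  finally show ?thesis .
qed

lemma homogeneous_form_cmult:
  assumes "homogeneous_form d g"
  shows "homogeneous_form d (\<lambda>x. c * g x)"
proof -
  obtain p where p: "mpoly_homogeneous d p" "\<And>x. mpoly_eval p x = g x"
    using assms unfolding homogeneous_form_def by blast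
  have "homogeneous_form d (\<lambda>x. \<Sum>m\<in>Poly_Mapping.keys p.
      (c * Poly_Mapping.lookup p m) * (\<Prod>i\<in>UNIV. x $ i ^ Poly_Mapping.lookup m i))"
    by (intro homogeneous_form_sum homogeneous_form_monomial)
       (use p(1) in \<open>simp add: mpoly_homogeneous_def\<close>)
  also have "(\<lambda>x. \<Sum>m\<in>Poly_Mapping.keys p.
      (c * Poly_Mapping.lookup p m) * (\<Prod>i\<in>UNIV. x $ i ^ Poly_Mapping.lookup m i)) = (\<lambda>x. c * g x)"
    by (rule ext) (simp add: p(2)[symmetric] mpoly_eval_def sum_distrib_left mult_ac)
  finally show ?thesis .
qed

lemma homogeneous_form_diff:
  assumes "homogeneous_form d g" "homogeneous_form d h"
  shows "homogeneous_form d (\<lambda>x. g x - h x)"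
  using homogeneous_form_add[OF assms(1) homogeneous_form_cmult[OF assms(2), of "- 1"]] by simp

lemma homogeneous_form_contract_const:
  assumes "\<And>l. homogeneous_form d (\<lambda>w. f w l)"
  shows "homogeneous_form d (\<lambda>w. contract a (f w) l)"
  using assms
proof (induction l arbitrary: f)
  case (Cons z zs)
  have "homogeneous_form d (\<lambda>w. contract a (\<lambda>l. f w (z # l)) zs)"
    using Cons.IH[of "\<lambda>w l. f w (z # l)"] Cons.prems by simp
  then show ?case by (simp add: homogeneous_form_diff homogeneous_form_cmult Cons.prems)
qed (simp add: homogeneous_form_zero)

lemma homogeneous_form_contract_linear:
  assumes "\<And>z. linear_form (*s) (\<lambda>w. a w z)" "\<And>l. homogeneous_form d (\<lambda>w. f w l)"
  shows "homogeneous_form (Suc d) (\<lambda>w. contract (a w) (f w) l)"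
  using assms(2)
proof (induction l arbitrary: f)
  case (Cons z zs)
  have "homogeneous_form (Suc d) (\<lambda>w. contract (a w) (\<lambda>l. f w (z # l)) zs)"
    using Cons.IH[of "\<lambda>w l. f w (z # l)"] Cons.prems by simp
  then show ?case
    by (simp add: homogeneous_form_diff homogeneous_form_times_linear assms(1) Cons.prems)
qed (simp add: homogeneous_form_zero)

lemma homogeneous_form_pfaffian:
  assumes "\<And>x y. linear_form (*s) (\<lambda>w. A w x y)"
  shows "homogeneous_form n (\<lambda>w. pfaffian (A w) n l)"
proof (induction n arbitrary: l)
  case 0
  show ?case by (simp add: homogeneous_form_const)
next
  case (Suc n)
  show ?case
  proof (cases l)
    case (Cons x xs)
    then show ?thesis by (simp add: homogeneous_form_contract_linear assms Suc)
  qed (simp add: homogeneous_form_zero)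
qed

text \<open>One factor of each term comes from \<open>M\<close> and is constant, so among the \<open>n + 1\<close> factors \<open>n\<close> are linear in
  \<open>w\<close>.\<close>

lemma homogeneous_form_dpfaffian:
  assumes "\<And>x y. linear_form (*s) (\<lambda>w. A w x y)"
  shows "homogeneous_form n (\<lambda>w. dpfaffian (A w) M (Suc n) l)"
proof (induction n arbitrary: l)
  case 0
  show ?case
  proof (cases l)
    case (Cons x xs)
    have "dpfaffian (A w) M 0 = (\<lambda>l. 0)" for w by (rule ext) simp
    moreover have "homogeneous_form 0 (\<lambda>w. contract (M x) (pfaffian (A w) 0) xs)"
      by (intro homogeneous_form_contract_const homogeneous_form_pfaffian assms)
    ultimately show ?thesis using Cons by (simp add: contract_zero)
  qed (simp add: homogeneous_form_zero)
next
  case (Suc n)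
  show ?case
  proof (cases l)
    case (Cons x xs)
    have "homogeneous_form (Suc n) (\<lambda>w. contract (M x) (pfaffian (A w) (Suc n)) xs)"
      by (intro homogeneous_form_contract_const homogeneous_form_pfaffian assms)
    moreover have "homogeneous_form (Suc n) (\<lambda>w. contract (A w x) (dpfaffian (A w) M (Suc n)) xs)"
      by (intro homogeneous_form_contract_linear assms Suc)
    ultimately show ?thesis
      unfolding Cons dpfaffian.simps(2)[of _ _ "Suc n"] list.case by (rule homogeneous_form_add)
  qed (simp add: homogeneous_form_zero)
qed

section \<open>Singular pairs of trilinear forms\<close>

text \<open>The forms, padded by zeros, are the components of an endomorphism that is not surjective and
  therefore not injective.\<close>

lemma common_zero:
  fixes ls :: "('k::field ^ 'n::finite \<Rightarrow> 'k) list"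
  assumes lin: "\<And>f. f \<in> set ls \<Longrightarrow> linear_form (*s) f" and len: "length ls < CARD('n)"
  shows "\<exists>x. x \<noteq> 0 \<and> (\<forall>f\<in>set ls. f x = 0)"
proof -
  obtain idx :: "'n \<Rightarrow> nat" where idx: "bij_betw idx UNIV {0..<CARD('n)}"
    using ex_bij_betw_finite_nat[of "UNIV :: 'n set"] by auto
  define F where "F x = (\<chi> i. if idx i < length ls then (ls ! idx i) x else 0)" for x
  have F: "Vector_Spaces.linear (*s) (*s) F"
    unfolding Vector_Spaces.linear_iff
    by (auto simp: F_def vec_eq_iff vec.linear_form_add[OF lin] vec.linear_form_scale[OF lin] vec.vector_space_axioms)
  obtain i where i: "idx i = length ls"
    using idx len unfolding bij_betw_def by (metis atLeastLessThan_iff imageE le0)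
  have "F x $ i \<noteq> axis i 1 $ i" for x by (simp add: F_def i axis_def)
  then have "\<not> surj F" by (metis surjD)
  then have "\<not> inj F" using vec.linear_injective_imp_surjective[OF F] by blast
  then obtain x y where xy: "F x = F y" "x \<noteq> y" by (auto simp: inj_def)
  have "f (x - y) = 0" if "f \<in> set ls" for f
  proof -
    obtain j where j: "j < length ls" "f = ls ! j" using \<open>f \<in> set ls\<close> by (metis in_set_conv_nth)
    have "j \<in> idx ` UNIV" using idx j(1) len unfolding bij_betw_def by simp
    then obtain k where "idx k = j" by blast
    then have "f x = f y" using arg_cong[OF xy(1), of "\<lambda>v. v $ k"] j by (simp add: F_def)
    then show ?thesis by (simp add: vec.linear_form_diff[OF lin[OF that]])
  qed
  then show ?thesis using xy(2) by (intro exI[of _ "x - y"]) auto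
qed

text \<open>The number of hyperbolic pairs in a maximal hyperbolic family \<open>l\<close> for \<open>A = \<omega> w\<close> takes the role of half the
  rank of \<open>A\<close>. There cannot be \<open>m + 1\<close> pairs, since \<open>w\<close> lies in the radical. With fewer than \<open>m\<close>
  pairs the linear conditions on \<open>u\<close> (orthogonal to \<open>l\<close>, \<open>M w u = 0\<close>, one coordinate zero) have a
  common non-trivial solution by counting. With exactly \<open>m\<close> pairs the condition \<open>M w u = 0\<close> has to be
  dropped from the count, and it follows from the vanishing of \<open>dpfaffian\<close> at \<open>w\<close>, \<open>u\<close> and \<open>l\<close>. The
  coordinate \<open>i\<close> in the conclusion expresses that \<open>u\<close> and \<open>w\<close> are linearly independent.\<close>

theorem singular_pair_from_form:
  fixes \<omega> :: "'k::field ^ 'n::finite \<Rightarrow> 'k ^ 'n \<Rightarrow> 'k ^ 'n \<Rightarrow> 'k" and M :: "'k ^ 'n \<Rightarrow> 'k ^ 'n \<Rightarrow> 'k"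
  assumes \<omega>: "alternating3 (*s) \<omega>" and M: "alternating2 (*s) M" and dim: "CARD('n) = 2 * Suc m"
    and solvable: "\<And>f :: ('n \<Rightarrow>\<^sub>0 nat) \<Rightarrow>\<^sub>0 'k. mpoly_homogeneous m f \<Longrightarrow> \<exists>x. x \<noteq> 0 \<and> mpoly_eval f x = 0"
  shows "\<exists>w u i. w $ i \<noteq> 0 \<and> u $ i = 0 \<and> u \<noteq> 0 \<and> (\<forall>z. \<omega> w u z = 0) \<and> M w u = 0"
proof -
  obtain es :: "('k ^ 'n) list" where es: "distinct es" "set es = cart_basis"
    using finite_distinct_list[OF finite_cart_basis] by blast
  have len: "length es = 2 * Suc m"
    using distinct_card[OF es(1)] es(2) dim by (simp add: card_cart_basis)
  have span_es: "vec.span (set es) = UNIV" using es(2) by (simp add: vec.span_Basis)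
  have "homogeneous_form m (\<lambda>w. dpfaffian (\<omega> w) M (Suc m) es)"
    by (rule homogeneous_form_dpfaffian) (rule vec.alternating2_left[OF vec.alternating3_thd[OF \<omega>]])
  then obtain w where w: "w \<noteq> 0" and q: "dpfaffian (\<omega> w) M (Suc m) es = 0"
    using solvable unfolding homogeneous_form_def by metis
  define A where "A = \<omega> w"
  have A: "alternating2 (*s) A" unfolding A_def by (rule vec.alternating3_fst[OF \<omega>])
  have Aw: "A w = (\<lambda>z. 0)"
    unfolding A_def using vec.alternating2_self[OF vec.alternating3_thd[OF \<omega>]] by auto
  \<comment> \<open>The coefficient of \<open>t\<close> vanishes in the standard basis, hence on every list.\<close>
  have dpf0: "dpfaffian A M (Suc m) vs = 0" if "length vs = 2 * Suc m" for vs
    by (rule vec.alternating_multilinear_vanish[OF vec.list_alternating_dpfaffian[OF A M]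
          vec.list_multilinear_dpfaffian[OF A M] es(1) span_es])
      (use q that len in \<open>simp_all only: A_def\<close>)
  \<comment> \<open>The Pfaffian vanishes in a basis that begins with the radical vector \<open>w\<close>.\<close>
  have pf0: "pfaffian A (Suc m) vs = 0" if vs: "length vs = 2 * Suc m" for vs
  proof -
    have "vec.independent {w}" using w by simp
    then obtain B where B: "{w} \<subseteq> B" "vec.independent B" "UNIV \<subseteq> vec.span B"
      using vec.maximal_independent_subset_extend[of "{w}" UNIV] by (metis subset_UNIV)
    have finB: "finite B" by (rule vec.finiteI_independent[OF B(2)])
    have cardB: "card B = 2 * Suc m"
      using vec.basis_card_eq_dim[OF subset_UNIV B(3,2)] dim by (simp add: card_cart_basis)
    obtain bs where bs: "distinct bs" "set bs = B - {w}"
      using finite_distinct_list[of "B - {w}"] finB by auto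
    show ?thesis
    proof (rule vec.alternating_multilinear_vanish[OF vec.list_alternating_pfaffian[OF A]
          vec.list_multilinear_pfaffian[OF A]])
      show "distinct (w # bs)" "vec.span (set (w # bs)) = UNIV"
        using bs B by (auto simp: insert_absorb)
      show "pfaffian A (Suc m) (w # bs) = 0" by (rule pfaffian_radical[of A w, OF Aw])
      have "length (w # bs) = card (set (w # bs))"
        using distinct_card[of "w # bs"] bs by auto
      also have "set (w # bs) = B" using bs(2) B(1) by auto
      finally show "length vs = length (w # bs)" using vs cardB by simp
    qed
  qed
  define good where "good l \<longleftrightarrow> hyperbolic A l \<and> length l \<le> 2 * Suc m" for l
  have "good []" "\<forall>y. good y \<longrightarrow> length y < Suc (2 * Suc m)" by (auto simp: good_def)
  then obtain l where l: "good l" "\<And>l'. good l' \<Longrightarrow> length l' \<le> length l"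
    using ex_has_greatest_nat[of good "[]" length "Suc (2 * Suc m)"] by blast
  have hyp: "hyperbolic A l" using l(1) by (simp add: good_def)
  have "length l \<noteq> 2 * Suc m"
    using pf0[of l] pfaffian_hyperbolic[OF hyp, of "Suc m"] by auto
  then have lm: "length l \<le> 2 * m"
    using l(1)[unfolded good_def, THEN conjunct2] even_length_hyperbolic[OF hyp] by presburger
  \<comment> \<open>By maximality, everything orthogonal to \<open>l\<close> lies in the radical.\<close>
  have rad: "A u = (\<lambda>z. 0)" if u: "\<And>z. z \<in> set l \<Longrightarrow> A z u = 0" for u
  proof (rule ext, rule ccontr)
    fix v assume "A u v \<noteq> 0"
    then obtain a b where "hyperbolic A (a # b # l)"
      using vec.hyperbolic_extend[OF A hyp u] by blast
    then have "good (a # b # l)" using lm by (simp add: good_def)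
    then show False using l(2) by fastforce
  qed
  obtain i where i: "w $ i \<noteq> 0" using w by (auto simp: vec_eq_iff)
  have coord: "linear_form (*s) (\<lambda>x :: 'k ^ 'n. x $ i)" by (simp add: vec.linear_form_iff)
  note lin = vec.alternating2_right[OF A] vec.alternating2_right[OF M] coord
  have "\<exists>u. u \<noteq> 0 \<and> u $ i = 0 \<and> (\<forall>z\<in>set l. A z u = 0) \<and> M w u = 0"
  proof (cases "length l = 2 * m")
    case False
    then have "length l + 2 \<le> 2 * m"
      using lm even_length_hyperbolic[OF hyp] by presburger
    then have "\<exists>u. u \<noteq> 0 \<and> (\<forall>f\<in>set (map A l @ [M w, \<lambda>x. x $ i]). f u = 0)"
      using lin dim by (intro common_zero) auto
    then show ?thesis by auto
  next
    case True
    then have "\<exists>u. u \<noteq> 0 \<and> (\<forall>f\<in>set (map A l @ [\<lambda>x. x $ i]). f u = 0)"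
      using lin dim by (intro common_zero) auto
    then obtain u where u: "u \<noteq> 0" "u $ i = 0" "\<And>z. z \<in> set l \<Longrightarrow> A z u = 0" by auto
    have "M w u * pfaffian A m l = 0"
      using dpf0[of "w # u # l"] True
      by (simp add: dpfaffian_radical[OF Aw rad[OF u(3)]] del: dpfaffian.simps)
    then have "M w u = 0" using pfaffian_hyperbolic[OF hyp True] by simp
    then show ?thesis using u by blast
  qed
  then obtain u where u: "u \<noteq> 0" "u $ i = 0" "\<And>z. z \<in> set l \<Longrightarrow> A z u = 0" "M w u = 0" by blast
  have "\<omega> w u z = 0" for z using rad[OF u(3)] unfolding A_def by metis
  then show ?thesis using i u by blast
qed

section \<open>Hyperplanes of the Grassmannian\<close>

text \<open>Triples of dependent vectors are included, so that the relation behaves like the vanishing of an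
  alternating trilinear form.\<close>

definition spans_in ::
  "('k::field \<Rightarrow> 'v::ab_group_add \<Rightarrow> 'v) \<Rightarrow> 'v set set \<Rightarrow> 'v \<Rightarrow> 'v \<Rightarrow> 'v \<Rightarrow> bool" where
  "spans_in scl H x y z \<longleftrightarrow>
     (vector_space.dim scl (module.span scl {x, y, z}) = 3 \<longrightarrow> module.span scl {x, y, z} \<in> H)"

context finite_dimensional_vector_space
begin

lemma dim_span_triple:
  assumes "dim (span {x, y}) = 2"
  shows "dim (span {x, y, z}) = 3 \<longleftrightarrow> z \<notin> span {x, y}"
proof -
  have "{x, y, z} = insert z {x, y}" by auto
  then show ?thesis using assms by (simp add: dim_insert del: insert_commute)
qed

lemma span_pair_le: "dim (span {x, y}) \<le> 2"
  using dim_le_card'[of "{x, y}"] card_insert_le_m1[of 2 "{y}" x] by simp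

text \<open>For independent \<open>x\<close>, \<open>y\<close> let \<open>Y\<close> be their span. The planes through \<open>Y\<close> correspond to points of a projective
  space whose lines are those lines of the geometry that have \<open>Y\<close> as lower end. The two hyperplane axioms say
  that the planes through \<open>Y\<close> in \<open>H\<close> form a subspace that meets every line, that is, a subspace of
  codimension at most 1.\<close>

lemma section_linear_form:
  assumes H: "grass_hyperplane scale 3 H"
  shows "\<exists>f. linear_form scale f \<and> (\<forall>z. spans_in scale H x y z \<longleftrightarrow> f z = 0)"
proof (cases "dim (span {x, y}) = 2")
  case False
  have "dim (span {x, y, z}) \<noteq> 3" for z
  proof -
    have "{x, y, z} = insert z {x, y}" by auto
    then have "dim (span {x, y, z}) \<le> dim (span {x, y}) + 1" by (simp add: dim_insert)
    then show ?thesis using False span_pair_le[of x y] by linarith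
  qed
  then show ?thesis using linear_form_const_zero by (auto simp: spans_in_def)
next
  case dim2: True
  let ?Y = "span {x, y}"
  let ?G = "\<lambda>z. span {x, y, z}"
  define S where "S = {z. spans_in scale H x y z}"
  have S_iff: "z \<in> S \<longleftrightarrow> z \<in> ?Y \<or> ?G z \<in> H" for z
    using dim_span_triple[OF dim2] by (auto simp: S_def spans_in_def)
  have G_iff: "u \<in> ?G z \<longleftrightarrow> (\<exists>t. u - scale t z \<in> ?Y)" for u z
  proof -
    have "{x, y, z} = insert z {x, y}" by auto
    then show ?thesis using span_breakdown_eq[of u z "{x, y}"] by simp
  qed
  have YG: "?Y \<subseteq> ?G z" for z by (rule span_mono) auto
  have zG: "z \<in> ?G z" for z by (simp add: span_base)
  have Gpoint: "?G z \<in> grass_points scale 3" if "z \<notin> ?Y" for z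
    using dim_span_triple[OF dim2] that by (simp add: grass_points_def)
  have G_eq: "?G u = ?G z" if "u \<in> ?G z" "u \<notin> ?Y" for u z
  proof (rule subspace_dim_equal)
    show "?G u \<subseteq> ?G z" using that YG zG by (intro span_minimal) (auto intro: span_base)
    show "dim (?G z) \<le> dim (?G u)"
    proof -
      have "z \<notin> ?Y" using that(1,2) YG[of z] by (metis G_iff span_add_eq span_scale diff_add_cancel span_diff)
      then have "dim (?G z) = 3" "dim (?G u) = 3" using dim_span_triple[OF dim2] that(2) by blast+
      then show ?thesis by simp
    qed
  qed (rule subspace_span)+
  have H_sub: "geom_subspace (grass_points scale 3) (grass_lines scale 3) H"
    and H_meet: "\<And>L. L \<in> grass_lines scale 3 \<Longrightarrow> L \<inter> H \<noteq> {}"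
    using H by (auto simp: grass_hyperplane_def geom_hyperplane_def)
  define L where "L u v = {U \<in> grass_points scale 3. ?Y \<subset> U \<and> U \<subset> span {x, y, u, v}}" for u v
  have dim_quadruple: "dim (span {x, y, u, v}) = 4" if "u \<notin> ?Y" "v \<notin> ?G u" for u v
  proof -
    have "{x, y, u, v} = insert v {x, y, u}" by auto
    then show ?thesis using dim_span_triple[OF dim2, of u] that by (simp add: dim_insert)
  qed
  have line: "L u v \<in> grass_lines scale 3" if "u \<notin> ?Y" "v \<notin> ?G u" for u v
  proof -
    have "?Y \<subseteq> span {x, y, u, v}" by (rule span_mono) auto
    moreover have "u \<in> span {x, y, u, v}" by (simp add: span_base)
    ultimately have "?Y \<subset> span {x, y, u, v}" using that(1) by blast
    then show ?thesis
      unfolding grass_lines_def L_def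
      by (intro CollectI exI[of _ ?Y] exI[of _ "span {x, y, u, v}"] conjI)
        (use dim2 dim_quadruple[OF that] in simp_all)
  qed
  have inL: "?G w \<in> L u v"
    if "u \<notin> ?Y" "v \<notin> ?G u" "w \<in> span {x, y, u, v}" "w \<notin> ?Y" for u v w
  proof -
    have "dim (?G w) \<noteq> dim (span {x, y, u, v})"
      using dim_span_triple[OF dim2, of w] dim_quadruple[OF that(1,2)] that(4) by simp
    then have "?G w \<noteq> span {x, y, u, v}" by metis
    moreover have "?G w \<subseteq> span {x, y, u, v}"
      using that(3) by (intro span_minimal) (auto intro: span_base)
    ultimately have "?G w \<subset> span {x, y, u, v}" by blast
    moreover have "?Y \<subset> ?G w" using YG zG that(4) by blast
    ultimately show ?thesis using Gpoint[OF that(4)] by (simp add: L_def)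
  qed
  have "subspace S"
  proof (rule subspaceI)
    show "0 \<in> S" by (simp add: S_iff span_zero)
    fix c u assume u: "u \<in> S"
    have "scale c u \<in> ?G u" using zG by (rule span_scale)
    then show "scale c u \<in> S"
      using u G_eq[of "scale c u" u] span_scale[of u "{x, y}" c] unfolding S_iff by metis
  next
    fix u v assume uv: "u \<in> S" "v \<in> S"
    show "u + v \<in> S"
    proof (cases "u + v \<in> ?Y")
      case True then show ?thesis by (simp add: S_iff)
    next
      case out: False
      show ?thesis
      proof (cases "u \<in> ?Y")
        case True
        then have "u + v \<in> ?G v" using YG zG by (blast intro: span_add)
        moreover have "v \<notin> ?Y" using out True span_add by blast
        ultimately show ?thesis using G_eq[OF _ out] uv(2) by (auto simp: S_iff)
      next
        case u: False
        then have uH: "?G u \<in> H" using uv by (simp add: S_iff)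
        show ?thesis
        proof (cases "v \<in> ?G u")
          case True
          then have "u + v \<in> ?G u" using zG by (blast intro: span_add)
          then show ?thesis using G_eq[OF _ out] uH by (simp add: S_iff)
        next
          case v: False
          then have vY: "v \<notin> ?Y" using YG by blast
          then have vH: "?G v \<in> H" using uv by (simp add: S_iff)
          have Z: "u \<in> span {x, y, u, v}" "v \<in> span {x, y, u, v}" by (auto intro: span_base)
          have "?G u \<noteq> ?G v" using v zG by blast
          moreover have "?G u \<in> L u v" "?G v \<in> L u v" "?G (u + v) \<in> L u v"
            using Z by (auto intro!: inL u v vY out intro: span_add)
          ultimately have "?G (u + v) \<in> H"
            using H_sub line[OF u v] uH vH unfolding geom_subspace_def by blast
          then show ?thesis by (simp add: S_iff)
        qed
      qed
    qed
  qed
  moreover have "\<exists>t. u - scale t v \<in> S" if vS: "v \<notin> S" for u v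
  proof (cases "u \<in> ?G v")
    case True
    then show ?thesis by (auto simp: G_iff S_iff)
  next
    case u: False
    have v: "v \<notin> ?Y" using vS by (simp add: S_iff)
    obtain U where U: "U \<in> L v u" "U \<in> H" using H_meet[OF line[OF v u]] by blast
    then obtain w where w: "w \<in> U" "w \<notin> ?Y" "w \<in> span {x, y, v, u}" by (auto simp: L_def)
    have GU: "?G w = U"
    proof (rule subspace_dim_equal)
      show "subspace U" using U by (simp add: L_def grass_points_def)
      then show "?G w \<subseteq> U" using U w by (intro span_minimal) (auto simp: L_def intro: span_base)
      show "dim U \<le> dim (?G w)" using dim_span_triple[OF dim2, of w] w U by (simp add: L_def grass_points_def)
    qed (rule subspace_span)
    have 4: "{x, y, v, u} = insert u {x, y, v}" by auto
    obtain b where "w - scale b u \<in> ?G v" using w(3) span_breakdown_eq[of w u "{x, y, v}"] unfolding 4 by blast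
    then obtain a where a: "w - scale b u - scale a v \<in> ?Y" unfolding G_iff by blast
    have b: "b \<noteq> 0"
    proof
      assume "b = 0"
      then have "w \<in> ?G v" using a by (auto simp: G_iff)
      then have "?G w = ?G v" using w(2) by (rule G_eq)
      then show False using vS GU U by (simp add: S_iff)
    qed
    define z where "z = u - scale (- a / b) v"
    have "w - scale b z \<in> ?Y" using a b by (simp add: z_def algebra_simps)
    then have wz: "w \<in> ?G z" by (auto simp: G_iff)
    then have "?G z \<in> H" using G_eq[OF wz w(2)] GU U by simp
    then have "z \<in> S" unfolding S_iff by blast
    then show ?thesis unfolding z_def by blast
  qed
  ultimately show ?thesis
    using kernel_of_linear_form[of S] by (simp add: S_def)
qed

lemma null_rel3_spans_in:
  assumes H: "grass_hyperplane scale 3 H"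
  shows "null_rel3 scale (spans_in scale H)"
proof -
  have sym: "spans_in scale H x y z = spans_in scale H y x z" "spans_in scale H x y z = spans_in scale H x z y" for x y z
    by (simp_all add: spans_in_def insert_commute)
  have self: "spans_in scale H x x z" for x z
    using span_pair_le[of x z] by (auto simp: spans_in_def)
  have "null_rel2 scale (spans_in scale H x)" for x
    unfolding null_rel2_def using section_linear_form[OF H, of x] sym self by metis
  moreover have "null_rel2 scale (\<lambda>x y. spans_in scale H x y z)" for z
    unfolding null_rel2_def using section_linear_form[OF H, of z] sym self by metis
  ultimately show ?thesis by (simp add: null_rel3_def)
qed

text \<open>Shult's theorem for subspaces of dimension 3.\<close>

theorem grass_hyperplane_alternating3:
  assumes H: "grass_hyperplane scale 3 H"
  shows "\<exists>\<phi>. alternating3 scale \<phi> \<and> (\<forall>x y z. spans_in scale H x y z \<longleftrightarrow> \<phi> x y z = 0)"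
proof -
  have lin: "linear_form scale (\<lambda>x. representation Basis x b)" for b
    by (simp add: linear_form_iff representation_add representation_scale independent_Basis span_Basis)
  have "(\<Sum>b\<in>Basis. scale (representation Basis x b) b) = x" for x
    by (rule sum_representation_eq[OF independent_Basis _ finite_Basis]) (simp_all add: span_Basis)
  then show ?thesis
    using null_rel3_imp_alternating3[where l = "\<lambda>b x. representation Basis x b" and e = "\<lambda>b. b",
        OF null_rel3_spans_in[OF H] finite_Basis lin]
    by simp
qed

lemma upper_radicalI:
  assumes \<phi>: "\<And>z. spans_in scale H x y z" and ind: "dim (span {x, y}) = 2"
  shows "span {x, y} \<in> upper_radical scale H"
proof -
  have "U \<in> H" if U: "U \<in> grass_points scale 3" "span {x, y} \<subseteq> U" for U
  proof -
    have sub: "subspace U" and dimU: "dim U = 3" using U(1) by (auto simp: grass_points_def)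
    have "U \<noteq> span {x, y}" using ind dimU by auto
    then obtain z where z: "z \<in> U" "z \<notin> span {x, y}" using U(2) by blast
    have d3: "dim (span {x, y, z}) = 3" using dim_span_triple[OF ind] z(2) by simp
    have "span {x, y, z} = U"
    proof (rule subspace_dim_equal)
      show "span {x, y, z} \<subseteq> U"
        using U(2) z(1) sub by (intro span_minimal) (auto intro: span_base)
    qed (use sub dimU d3 in simp_all)
    then show ?thesis using \<phi>[of z] d3 by (simp add: spans_in_def)
  qed
  then show ?thesis using ind by (simp add: upper_radical_def grass_points_def)
qed

end

theorem corollary1p8:
  fixes scl :: "'k::field \<Rightarrow> 'v::ab_group_add \<Rightarrow> 'v"
  assumes "perfect_field TYPE('k)"
    and "field_cohomological_dim TYPE('k) \<le> 1"
    and "\<And>f :: (8 \<Rightarrow>\<^sub>0 nat) \<Rightarrow>\<^sub>0 'k. mpoly_homogeneous 3 f \<Longrightarrow>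
           \<exists>x :: 'k ^ 8. x \<noteq> 0 \<and> mpoly_eval f x = 0"
    and "vector_space scl"
    and "vector_space.dim scl UNIV = 9"
    and "grass_hyperplane scl 3 H"
  shows "upper_radical scl H \<noteq> {}"
proof -
  interpret vector_space scl by fact
  obtain B where B: "independent B" "UNIV \<subseteq> span B" "card B = 9"
    using basis_exists[of UNIV] assms(5) by metis
  have finB: "finite B" using B(3) by (metis card.infinite zero_neq_numeral)
  interpret finite_dimensional_vector_space scl B
    by unfold_locales (use B finB in auto)
  obtain \<phi> where \<phi>: "alternating3 scl \<phi>" "\<And>x y z. spans_in scl H x y z \<longleftrightarrow> \<phi> x y z = 0"
    using grass_hyperplane_alternating3[OF assms(6)] by blast
  obtain e where e: "e \<in> B" using B(3) by fastforce
  have "card (UNIV :: 8 set) = card (B - {e})" using B(3) e finB by simp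
  then obtain g :: "8 \<Rightarrow> 'v" where g: "bij_betw g UNIV (B - {e})"
    using finite_same_card_bij[of "UNIV :: 8 set" "B - {e}"] finB by auto
  define \<iota> where "\<iota> x = (\<Sum>i\<in>UNIV. scl (x $ i) (g i))" for x :: "'k ^ 8"
  have \<iota>_add: "\<iota> (x + y) = \<iota> x + \<iota> y" and \<iota>_scale: "\<iota> (c *s x) = scl c (\<iota> x)" for x y c
    by (simp_all add: \<iota>_def scale_left_distrib sum.distrib scale_sum_right)
  have lin\<iota>: "linear_form (*s) (\<lambda>x. f (\<iota> x))" if "linear_form scl f" for f
    unfolding vec.linear_form_iff by (simp add: \<iota>_add \<iota>_scale linear_form_simps[OF that])
  have alt\<iota>: "alternating2 (*s) (\<lambda>x y. \<beta> (\<iota> x) (\<iota> y))" if "alternating2 scl \<beta>" for \<beta>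
    unfolding alternating2_def
    using lin\<iota>[OF alternating2_left[OF that]] lin\<iota>[OF alternating2_right[OF that]] alternating2_self[OF that] by blast
  have \<omega>: "alternating3 (*s) (\<lambda>x y z. \<phi> (\<iota> x) (\<iota> y) (\<iota> z))"
    unfolding alternating3_def using alt\<iota>[OF alternating3_fst[OF \<phi>(1)]] alt\<iota>[OF alternating3_thd[OF \<phi>(1)]] by blast
  have M: "alternating2 (*s) (\<lambda>x y. \<phi> e (\<iota> x) (\<iota> y))"
    by (rule alt\<iota>[OF alternating3_fst[OF \<phi>(1)]])
  obtain w u :: "'k ^ 8" and i where w: "w $ i \<noteq> 0" "u $ i = 0" "u \<noteq> 0"
    and sing: "\<And>z. \<phi> (\<iota> w) (\<iota> u) (\<iota> z) = 0" "\<phi> e (\<iota> w) (\<iota> u) = 0"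
    using singular_pair_from_form[OF \<omega> M _ assms(3)] by auto
  have zero: "\<phi> (\<iota> w) (\<iota> u) v = 0" for v
  proof -
    note l = alternating2_right[OF alternating3_fst[OF \<phi>(1)]]
    have "B \<subseteq> {v. \<phi> (\<iota> w) (\<iota> u) v = 0}"
    proof
      fix b assume b: "b \<in> B"
      show "b \<in> {v. \<phi> (\<iota> w) (\<iota> u) v = 0}"
      proof (cases "b = e")
        case True
        have "\<phi> (\<iota> w) (\<iota> u) e = \<phi> e (\<iota> w) (\<iota> u)"
          using alternating3_swap23[OF \<phi>(1), of "\<iota> w" "\<iota> u" e] alternating3_swap12[OF \<phi>(1), of "\<iota> w" e "\<iota> u"]
          by (metis minus_minus)
        then show ?thesis using True sing(2) by simp
      next
        case False
        then obtain j where j: "b = g j" using b g unfolding bij_betw_def by blast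
        have "\<iota> (axis j 1) = (\<Sum>i\<in>UNIV. if i = j then g i else 0)"
          unfolding \<iota>_def by (rule sum.cong) (auto simp: axis_def)
        then have "\<iota> (axis j 1) = b" by (simp add: j)
        then show ?thesis using sing(1) by auto
      qed
    qed
    moreover have "subspace {v. \<phi> (\<iota> w) (\<iota> u) v = 0}"
      by (rule subspaceI) (simp_all add: linear_form_zero[OF l] linear_form_add[OF l] linear_form_scale[OF l])
    ultimately have "span B \<subseteq> {v. \<phi> (\<iota> w) (\<iota> u) v = 0}" by (rule span_minimal)
    then show ?thesis using B(2) by blast
  qed
  have coord: "representation B (\<iota> x) (g j) = x $ j" for x j
  proof -
    have l: "linear_form scl (\<lambda>x. representation B x (g j))"
      using B by (simp add: linear_form_iff representation_add representation_scale top.extremum_unique)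
    have "representation B (\<iota> x) (g j) = (\<Sum>i\<in>UNIV. x $ i * representation B (g i) (g j))"
      unfolding \<iota>_def by (simp add: linear_form_sum[OF l] linear_form_scale[OF l])
    also have "\<dots> = (\<Sum>i\<in>UNIV. if i = j then x $ i else 0)"
    proof (rule sum.cong)
      fix i
      have "g i \<in> B" and "g j = g i \<longleftrightarrow> i = j"
        using g by (auto simp: bij_betw_def inj_def)
      then show "x $ i * representation B (g i) (g j) = (if i = j then x $ i else 0)"
        by (simp add: representation_basis[OF B(1)])
    qed simp
    finally show ?thesis by simp
  qed
  have "\<iota> w \<notin> span {\<iota> u}"
  proof
    assume "\<iota> w \<in> span {\<iota> u}"
    then obtain k where "\<iota> w = scl k (\<iota> u)" by (auto simp: span_singleton)
    then have "\<iota> w = \<iota> (k *s u)" by (simp add: \<iota>_scale)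
    then have "w $ i = (k *s u) $ i" by (metis coord)
    then show False using w by simp
  qed
  moreover have "\<iota> u \<noteq> 0"
  proof
    assume "\<iota> u = 0"
    then have "\<iota> u = \<iota> 0" by (simp add: \<iota>_def)
    then have "u = 0" unfolding vec_eq_iff by (metis coord)
    then show False using w by blast
  qed
  ultimately have "dim (span {\<iota> w, \<iota> u}) = 2" by (simp add: dim_insert)
  then have "span {\<iota> w, \<iota> u} \<in> upper_radical scl H"
    using upper_radicalI \<phi>(2) zero by blast
  then show ?thesis by blast
qed

end
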